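(* Let $\gamma^*(\mathcal D)$ be the optimal lower density of covering the plane by a sequence $(\mathcal D_n)_{n\in\mathbb N}$ of closed unit circular disks, with $C_n$ the center of $\mathcal D_n$ for all $n\in\mathbb N$, such that for all $n\ge 2$ the center $C_n$ lies in $\mathcal D_{n-1}$ and $\angle C_{n-1}C_nC_{n+1}\ge \frac{2\pi}{3}$. That is, $\gamma^*(\mathcal D)$ is the infimum, over all sequences $(\mathcal D_n)_{n\in\mathbb N}$ of closed unit disks with $\bigcup_{n}\mathcal D_n=\mathbb R^2$ such that for all $n\ge 2$ one has $C_n\in\mathcal D_{n-1}$ and $\angle C_{n-1}C_nC_{n+1}\ge\frac{2\pi}{3}$, of the lower density of the covering. Then $$\gamma^*(\mathcal D)\ \ge\ \frac{2\pi}{2+\sqrt 3}.$$ Moreover this bound can be achieved: there exists a sequence $(\mathcal D_n)_{n\in\mathbb N}$ of closed unit disks covering $\mathbb R^2$, with $C_n$ the center of $\mathcal D_n$, such that for all $n\ge 2$ the center $C_n$ lies in $\mathcal D_{n-1}$ and $\angle C_{n-1}C_nC_{n+1}\ge\frac{2\pi}{3}$, and whose lower density equals $\frac{2\pi}{2+\sqrt3}$.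
   Context: A closed unit circular disk is a congruent copy of $\mathcal D=\{(x,y)\in\mathbb R^2: x^2+y^2\le 1\}$. A family $\mathscr F=\{\mathcal D_n:n\in\mathbb N\}$ of closed unit disks is a covering of the plane if $\bigcup_{n}\mathcal D_n=\mathbb R^2$; a sequence $(\mathcal D_n)_{n\in\mathbb N}$ of closed unit disks with $\bigcup_n\mathcal D_n=\mathbb R^2$ is a sequence covering of the plane, and its (lower) density is that of the family $\mathscr F=\{\mathcal D_n:n\in\mathbb N\}$. Let $\mathcal I=[-1,1]\times[-1,1]$, and for $\lambda>0$ let $\lambda\mathcal I=\{\lambda x:x\in\mathcal I\}$. Write $a(\cdot)$ for area. Let $N_\lambda$ be the cardinality of the subfamily of $\mathscr F$ consisting of the disks that intersect the interior of $\lambda\mathcal I$, and $\gamma(\lambda,\mathscr F)=\frac{N_\lambda\cdot a(\mathcal D)}{a(\lambda\mathcal I)}$. The lower density of $\mathscr F$ is $\liminf_{\lambda\to\infty}\gamma(\lambda,\mathscr F)$. $\angle C_{n-1}C_nC_{n+1}$ denotes the measure in $[0,\pi]$ of the smaller of the two angles at $C_n$ between the segments $C_nC_{n-1}$ and $C_nC_{n+1}$; the angle condition presupposes that consecutive centers are distinct. *)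

theory Defs
  imports "HOL-Analysis.Analysis"
begin

text \<open>
  The congruent copies of the closed unit disk are exactly the balls \<open>cball c 1\<close>, and the
  center \<open>c\<close> is determined by the disk. A sequence of disks is therefore given by its sequence
  of centers. Sequences are indexed by 1, 2, 3, ...; the value at 0 is never used.
\<close>

definition unit_disk :: "real^2 \<Rightarrow> (real^2) set" where
  "unit_disk c = cball c 1"

definition disk_family :: "(nat \<Rightarrow> real^2) \<Rightarrow> (real^2) set set" where
  "disk_family C = {unit_disk (C n) | n. n \<ge> 1}"

definition square :: "(real^2) set" where
  "square = cbox (vector [-1, -1]) (vector [1, 1])"

text \<open>
  The cardinality of the subfamily is the counting measure, which is infinite for infinite sets
  (\<open>card\<close> would give 0): a covering need not be locally finite. The family is a set of
  disks, so a disk that occurs several times in a sequence is counted once.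
\<close>

definition density_ratio :: "real \<Rightarrow> (real^2) set set \<Rightarrow> ennreal" where
  "density_ratio r F =
     emeasure (count_space UNIV) {S \<in> F. S \<inter> interior ((*\<^sub>R) r ` square) \<noteq> {}}
       * emeasure lborel (unit_disk 0) / emeasure lborel ((*\<^sub>R) r ` square)"

definition lower_density :: "(real^2) set set \<Rightarrow> ennreal" where
  "lower_density F = Liminf at_top (\<lambda>r. density_ratio r F)"

text \<open>
  Measure in \<open>[0, pi]\<close> of the angle at \<open>B\<close> between the segments \<open>BA\<close> and \<open>BC\<close>;
  meaningful only if \<open>A\<close> and \<open>C\<close> differ from \<open>B\<close>.
\<close>

definition segment_angle :: "real^2 \<Rightarrow> real^2 \<Rightarrow> real^2 \<Rightarrow> real" where
  "segment_angle A B C = arccos (((A - B) \<bullet> (C - B)) / (norm (A - B) * norm (C - B)))"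

definition admissible_covering :: "(nat \<Rightarrow> real^2) \<Rightarrow> bool" where
  "admissible_covering C \<longleftrightarrow>
     \<Union> (disk_family C) = UNIV \<and>
     (\<forall>n\<ge>2. C n \<in> unit_disk (C (n - 1)) \<and>
            C (n - 1) \<noteq> C n \<and> C (n + 1) \<noteq> C n \<and>
            segment_angle (C (n - 1)) (C n) (C (n + 1)) \<ge> 2 * pi / 3)"

definition optimal_lower_density :: ennreal where
  "optimal_lower_density = (INF C \<in> {C. admissible_covering C}. lower_density (disk_family C))"

end

theory Submission
  imports Defs "HOL-Library.Discrete_Functions"
begin

text \<open>
  The Voronoi cells of the set of centers cover the plane, so it suffices to bound their mean area by
  \<open>1 + sqrt 3 / 2\<close>.
  Every center \<open>p\<close> but at most one has two centers \<open>q\<close>, \<open>r\<close> within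
  distance 1 which it sees under an angle of at least \<open>2 * pi / 3\<close>. Hence the cell of \<open>p\<close>
  is a polygon in the unit disk around \<open>p\<close>, cut off at distance at most \<open>1/2\<close> in two
  directions. In the extremal case two chords at distance \<open>1/2\<close> subtend \<open>2 * pi / 3\<close> each, and the
  other \<open>k - 2\<close> edges share the remaining \<open>2 * pi / 3\<close>. Linearizing \<open>sin\<close> at
  \<open>pi / 6\<close>, the value for \<open>k = 6\<close>, yields the bound
  \<open>1 + sqrt 3 / 2 + exc * (k - 6)\<close> for the area of a cell with \<open>k\<close> vertices,
  with a small constant \<open>exc \<ge> 0\<close>.

  It remains to see that \<open>k\<close> is at most 6 on average. Fix a generic direction. A Voronoi vertex
  with \<open>d \<ge> 3\<close> nearest centers is the highest or the lowest vertex of the cells of all of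
  these but the leftmost and the rightmost one. Each cell has one highest and one lowest vertex, so the sum of
  \<open>d - 2 \<ge> d / 3\<close> over all vertices is at most twice the number of centers.

  Equality holds for straight rows of disks at distance 1, consecutive rows being \<open>1 + sqrt 3 / 2\<close>
  apart and shifted by \<open>1/2\<close>. One sequence sweeps over all rows again and again, on longer and
  longer intervals; the additional disks needed to change rows have density 0.
\<close>

section \<open>Areas of triangles in the unit disk\<close>

text \<open>The line \<open>\<lambda>u. exc + kap * u\<close> is tangent to \<open>\<lambda>u. sin u / 2\<close> at
  \<open>u = pi / 6\<close>.\<close>

definition kap :: real where "kap = sqrt 3 / 4"
definition exc :: real where "exc = 1/4 - sqrt 3 * pi / 24"

lemma kap_pos: "kap > 0" by (simp add: kap_def)

text \<open>\<open>sin\<close> is concave on \<open>[0, pi]\<close>, so it stays below its tangent;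
  the proof reads this off the sign of the derivative on the two sides of
  \<open>pi / 6\<close>.\<close>

lemma sin_tangent:
  assumes "0 \<le> u" "u \<le> pi"
  shows "sin u / 2 \<le> exc + kap * u"
proof -
  define g where "g = (\<lambda>u. exc + kap * u - sin u / 2)"
  have d: "(g has_real_derivative (kap - cos x / 2)) (at x)" for x
    unfolding g_def by (auto intro!: derivative_eq_intros)
  have g0: "g (pi/6) = 0"
    by (simp add: g_def exc_def kap_def sin_30 field_simps)
  have "g u \<ge> g (pi/6)"
  proof (cases "u \<le> pi/6")
    case True
    show ?thesis
    proof (rule DERIV_nonpos_imp_nonincreasing[OF True], intro exI conjI)
      fix x assume x: "u \<le> x" "x \<le> pi/6"
      show "(g has_real_derivative (kap - cos x / 2)) (at x)" by (rule d)
      have "cos x \<ge> cos (pi/6)" using x assms by (intro cos_monotone_0_pi_le) auto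
      then show "kap - cos x / 2 \<le> 0" by (simp add: kap_def cos_30)
    qed
  next
    case False
    then have "pi/6 \<le> u" by simp
    show ?thesis
    proof (rule DERIV_nonneg_imp_nondecreasing[OF \<open>pi/6 \<le> u\<close>], intro exI conjI)
      fix x assume x: "pi/6 \<le> x" "x \<le> u"
      show "(g has_real_derivative (kap - cos x / 2)) (at x)" by (rule d)
      have "cos (pi/6) \<ge> cos x" using x assms by (intro cos_monotone_0_pi_le) auto
      then show "kap - cos x / 2 \<ge> 0" by (simp add: kap_def cos_30)
    qed
  qed
  then show ?thesis using g0 by (simp add: g_def)
qed

lemma exc_nonneg: "0 \<le> exc"
  using sin_tangent[of 0] by simp

lemma sqrt3_bounds: "17/10 < sqrt 3" "sqrt 3 < 18/10"
proof -
  show "17/10 < sqrt 3" by (rule real_less_rsqrt) (simp add: power2_eq_square)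
  show "sqrt 3 < 18/10" by (rule real_less_lsqrt) (simp_all add: power2_eq_square)
qed

lemma exc_le: "exc \<le> 1/10"
proof -
  have "17/10 * 3 \<le> sqrt 3 * pi"
    using sqrt3_bounds pi_gt3 by (intro mult_mono) auto
  then show ?thesis unfolding exc_def by linarith
qed

text \<open>A chord of the unit disk at distance \<open>1/2\<close> from the center is parametrized
  by the angle \<open>s \<in> {0..2 * pi / 3}\<close> from one of its endpoints: \<open>chord_rad s\<close> is the
  distance of the point from the center, \<open>tri_area s\<close> the area of the triangle between the two.\<close>

definition chord_rad :: "real \<Rightarrow> real" where "chord_rad s = 1 / (2 * cos (pi/3 - s))"
definition tri_area :: "real \<Rightarrow> real" where "tri_area s = chord_rad s * sin s / 2"

lemma cos_ge_half: "\<bar>x\<bar> \<le> pi/3 \<Longrightarrow> cos x \<ge> 1/2"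
  using cos_monotone_0_pi_le[of "\<bar>x\<bar>" "pi/3"] by (simp add: cos_60 cos_abs_real)

lemma chord_rad_bounds:
  assumes "0 \<le> s" "s \<le> 2*pi/3"
  shows "0 < chord_rad s" "chord_rad s \<le> 1"
proof -
  have "cos (pi/3 - s) \<ge> 1/2" using assms by (intro cos_ge_half abs_leI) auto
  then show "0 < chord_rad s" "chord_rad s \<le> 1" by (auto simp: chord_rad_def field_simps)
qed

lemma chord_rad_zero: "chord_rad 0 = 1" by (simp add: chord_rad_def cos_60)

lemma tri_area_nonneg: "0 \<le> s \<Longrightarrow> s \<le> 2*pi/3 \<Longrightarrow> 0 \<le> tri_area s"
  using chord_rad_bounds[of s] by (auto simp: tri_area_def intro!: mult_nonneg_nonneg sin_ge_zero)

text \<open>Measured from the midpoint of the chord, the base of the triangle runs from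
  \<open>tan (pi/3 - s) / 2\<close> to \<open>tan (pi/3) / 2\<close>; its height is
  \<open>1/2\<close>.\<close>

lemma tri_area_tan:
  assumes "0 \<le> s" "s \<le> 2*pi/3"
  shows "tri_area s = (sqrt 3 - tan (pi/3 - s)) / 8"
proof -
  have c: "cos (pi/3 - s) \<ge> 1/2" using assms by (intro cos_ge_half abs_leI) auto
  have "sin s = sin (pi/3 - (pi/3 - s))" by simp
  also have "\<dots> = sqrt 3 / 2 * cos (pi/3 - s) - 1/2 * sin (pi/3 - s)"
    by (subst sin_diff) (simp add: sin_60 cos_60)
  finally show ?thesis using c by (simp add: tri_area_def chord_rad_def tan_def field_simps)
qed

text \<open>At \<open>s = pi/3\<close> the midpoint of the chord is reached, and with it half of the
  full area \<open>sqrt 3 / 4\<close>.\<close>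

lemma tri_area_ge:
  assumes "pi/3 \<le> s" "s \<le> 2*pi/3"
  shows "tri_area s \<ge> sqrt 3 / 8"
proof -
  have "tan (pi/3 - s) \<le> tan 0"
  proof (cases "s = pi/3")
    case False
    then show ?thesis using assms by (intro less_imp_le[OF tan_monotone]) auto
  next
    case True
    show ?thesis unfolding True by simp
  qed
  then show ?thesis using assms by (subst tri_area_tan) auto
qed

text \<open>The left side is the component of the chord point along the endpoint of the chord. The
  bound \<open>sqrt 3 / 2 = 2 * kap\<close> is chosen so that the gap term in
  \<open>gap_ineq\<close> is absorbed by \<open>kap * u\<close> without spending
  \<open>exc\<close>.\<close>

lemma chord_cos_le:
  assumes "pi/3 \<le> s" "s \<le> 2*pi/3"
  shows "chord_rad s * cos s \<le> sqrt 3 / 2"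
proof -
  have c: "cos (pi/3 - s) \<ge> 1/2" using assms by (intro cos_ge_half abs_leI) auto
  have "cos s \<le> cos (pi/3)" using assms by (intro cos_monotone_0_pi_le) auto
  then have "cos s \<le> 1/2" by (simp add: cos_60)
  also have "\<dots> \<le> sqrt 3 * cos (pi/3 - s)" using c sqrt3_bounds
    mult_mono[of 1 "sqrt 3" "1/2" "cos (pi/3 - s)"] by linarith
  finally show ?thesis using c by (simp add: chord_rad_def field_simps)
qed

text \<open>The addition theorems split the left side into three terms: each of the two triangles
  below the chords times a factor at most 1, and a multiple of \<open>sin u\<close> for the
  gap.\<close>

lemma sin_sum3_le:
  fixes s u s' w w' :: real
  assumes s: "0 \<le> s" "s \<le> 2*pi/3" and s': "0 \<le> s'" "s' \<le> 2*pi/3"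
    and u: "0 \<le> u" and sum: "s + u + s' \<le> pi"
  shows "chord_rad s * chord_rad s' * sin (s + u + s') / 2 \<le> tri_area s + tri_area s' +
      max 0 (chord_rad s * cos s * (chord_rad s' * cos s')) * sin u / 2"
proof -
  define w w' where "w = chord_rad s" and "w' = chord_rad s'"
  have w: "0 < w" "w \<le> 1" "0 < w'" "w' \<le> 1"
    using chord_rad_bounds s s' by (auto simp: w_def w'_def)
  have sn: "0 \<le> sin s" "0 \<le> sin s'" "0 \<le> sin u" using s s' u sum by (auto intro!: sin_ge_zero)
  have "sin (s + u + s') = sin s * cos (u + s') + cos s * cos u * sin s' + cos s * cos s' * sin u"
    by (simp add: sin_add cos_add algebra_simps)
  then have eq: "w * w' * sin (s + u + s') = (w * sin s) * (w' * cos (u + s'))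
      + (w' * sin s') * (w * (cos s * cos u)) + (w * cos s) * (w' * cos s') * sin u"
    by (simp add: algebra_simps)
  have le1: "x * y \<le> 1" if "0 < x" "x \<le> 1" "y \<le> 1" for x y :: real
    using that mult_left_mono[of y 1 x] by linarith
  have a: "(w * sin s) * (w' * cos (u + s')) \<le> (w * sin s) * 1"
    using w sn by (intro mult_left_mono le1) auto
  have "\<bar>cos s * cos u\<bar> \<le> 1" unfolding abs_mult by (intro mult_le_one) auto
  then have b: "(w' * sin s') * (w * (cos s * cos u)) \<le> (w' * sin s') * 1"
    using w sn by (intro mult_left_mono[OF le1]) (auto simp: abs_le_iff)
  have c: "(w * cos s) * (w' * cos s') * sin u \<le> max 0 ((w * cos s) * (w' * cos s')) * sin u"
    using sn by (intro mult_right_mono) auto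
  show ?thesis
    using eq a b c unfolding tri_area_def w_def[symmetric] w'_def[symmetric] by (simp add: field_simps)
qed

text \<open>As \<open>s + s' <= pi\<close>, the two cosines are not both negative. So the product is
  nonpositive, or its factors lie in \<open>[0, B]\<close> and \<open>[0, 1]\<close>.\<close>

lemma cos_prod_le:
  assumes s: "0 \<le> s" "s \<le> 2*pi/3" and s': "0 \<le> s'" "s' \<le> 2*pi/3" and sum: "s + s' \<le> pi"
    and b: "chord_rad s * cos s \<le> B" "0 \<le> B"
  shows "max 0 (chord_rad s * cos s * (chord_rad s' * cos s')) \<le> B"
proof (cases "cos s \<ge> 0 \<and> cos s' \<ge> 0")
  case True
  have "chord_rad s' * cos s' \<le> 1"
    using chord_rad_bounds[OF s'] True by (intro mult_le_one) auto
  then have "chord_rad s * cos s * (chord_rad s' * cos s') \<le> B * 1"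
    using b True chord_rad_bounds[OF s'] chord_rad_bounds[OF s] by (intro mult_mono) auto
  then show ?thesis using b by simp
next
  case False
  have "cos s \<ge> 0 \<or> cos s' \<ge> 0"
  proof (cases "s \<le> pi/2")
    case False
    then have "s' \<le> pi/2" using sum by simp
    then show ?thesis using s' cos_ge_zero[of s'] by auto
  qed (use s cos_ge_zero[of s] in auto)
  then have "cos s * cos s' \<le> 0" using False by (auto simp: mult_le_0_iff)
  then have "chord_rad s * chord_rad s' * (cos s * cos s') \<le> 0"
    using chord_rad_bounds[OF s'] chord_rad_bounds[OF s] by (simp add: mult_le_0_iff zero_less_mult_iff)
  then show ?thesis using b by (simp add: mult_ac max_def)
qed

text \<open>The triangle spanned by the point at \<open>s\<close> before the end of one chord and the point at
  \<open>s'\<close> behind the beginning of the next one, with a gap \<open>u\<close> between the chords. The numbers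
  \<open>j\<close>, \<open>j'\<close> count the midpoints of chords that are passed.\<close>

lemma gap_ineq:
  assumes s: "0 \<le> s" "s \<le> 2*pi/3" and s': "0 \<le> s'" "s' \<le> 2*pi/3"
    and u: "0 \<le> u" and sum: "s + u + s' \<le> pi"
    and j: "j \<in> {0,1}" "j = 1 \<longrightarrow> pi/3 \<le> s" and j': "j' \<in> {0,1}" "j' = 1 \<longrightarrow> pi/3 \<le> s'"
  shows "chord_rad s * chord_rad s' * sin (s + u + s') / 2
      \<le> exc * (1 - j - j') + tri_area s + tri_area s' + kap * u"
proof -
  note main = sin_sum3_le[OF s s' u sum]
  have sn: "0 \<le> sin u" "sin u \<le> u" using u sum s s' by (auto intro!: sin_ge_zero sin_x_le_x)
  have ss: "s + s' \<le> pi" "s' + s \<le> pi" using u sum by auto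
  consider "j = 0" "j' = 0" | "j = 1" "j' = 0" | "j = 0" "j' = 1" | "j = 1" "j' = 1"
    using j j' by auto
  then show ?thesis
  proof cases
    case 1
    have "chord_rad s * cos s \<le> 1"
      using mult_left_mono[of "cos s" 1 "chord_rad s"] chord_rad_bounds[OF s] cos_le_one[of s] by linarith
    from cos_prod_le[OF s s' ss(1) this] 
    have "max 0 (chord_rad s * cos s * (chord_rad s' * cos s')) * sin u \<le> 1 * sin u"
      using sn by (intro mult_right_mono) auto
    then show ?thesis using main sin_tangent[of u] u sum s s' 1 by (auto simp: algebra_simps)
  next
    case 2
    from cos_prod_le[OF s s' ss(1) chord_cos_le] j 2 s
    have "max 0 (chord_rad s * cos s * (chord_rad s' * cos s')) * sin u \<le> (sqrt 3 / 2) * u"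
      using sn by (intro mult_mono) auto
    then show ?thesis using main 2 unfolding kap_def by (simp add: field_simps)
  next
    case 3
    from cos_prod_le[OF s' s ss(2) chord_cos_le] j' 3 s'
    have "max 0 (chord_rad s' * cos s' * (chord_rad s * cos s)) * sin u \<le> (sqrt 3 / 2) * u"
      using sn by (intro mult_mono) auto
    then show ?thesis using main 3 unfolding kap_def by (simp add: field_simps)
  next
    \<comment> \<open>With both midpoints passed the left side is at most \<open>1/4\<close>,
      whereas the two triangles alone contribute \<open>sqrt 3 / 4\<close>, which exceeds
      \<open>1/4 + exc\<close>.\<close>
    case 4
    have sg: "pi/3 \<le> s" "pi/3 \<le> s'" using j j' 4 by auto
    have w: "chord_rad s * chord_rad s' \<le> 1/ sqrt 3"
    proof -
      have *: "chord_rad x \<le> 1 / sqrt 3" if "pi/3 \<le> x" "x \<le> pi/2" for x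
      proof -
        have "cos (pi/3 - x) = cos (x - pi/3)" using cos_minus[of "x - pi/3"] by simp
        also have "\<dots> \<ge> cos (pi/6)" using that by (intro cos_monotone_0_pi_le) auto
        finally have "sqrt 3 \<le> 2 * cos (pi/3 - x)" by (simp add: cos_30)
        moreover have "0 < sqrt (3::real)" by simp
        ultimately show ?thesis unfolding chord_rad_def
          by (intro divide_left_mono mult_pos_pos) linarith+
      qed
      show ?thesis
      proof (cases "s \<le> pi/2")
        case True
        then have "chord_rad s * chord_rad s' \<le> 1/ sqrt 3 * 1"
          using *[OF sg(1)] chord_rad_bounds[OF s'] chord_rad_bounds[OF s] by (intro mult_mono) auto
        then show ?thesis by simp
      next
        case False
        then have "s' \<le> pi/2" using ss by auto
        then have "chord_rad s * chord_rad s' \<le> 1 * (1/ sqrt 3)"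
          using *[OF sg(2)] chord_rad_bounds[OF s'] chord_rad_bounds[OF s] by (intro mult_mono) auto
        then show ?thesis by simp
      qed
    qed
    have "sin (s + u + s') = sin (pi - (s + u + s'))" by simp
    also have "\<dots> \<le> sin (pi/3)" using sg u sum by (intro sin_monotone_2pi_le) auto
    finally have sl: "sin (s + u + s') \<le> sqrt 3 / 2" by (simp add: sin_60)
    have "0 \<le> sin (s + u + s')" using sum s s' u by (intro sin_ge_zero) auto
    then have "chord_rad s * chord_rad s' * sin (s + u + s') \<le> 1/ sqrt 3 * (sqrt 3 / 2)"
      using w sl chord_rad_bounds[OF s'] chord_rad_bounds[OF s] by (intro mult_mono) auto
    then have "chord_rad s * chord_rad s' * sin (s + u + s') / 2 \<le> 1/4" by simp
    moreover have "tri_area s + tri_area s' \<ge> sqrt 3 / 4"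
      using tri_area_ge[OF sg(1) s(2)] tri_area_ge[OF sg(2) s'(2)] by simp
    moreover have "0 \<le> kap * u" using u by (simp add: kap_def)
    ultimately show ?thesis using exc_le sqrt3_bounds 4 by simp
  qed
qed

section \<open>A potential for the edges of a polygon\<close>

text \<open>
  \<open>T\<close> is the set of directions, as lifted angles, in which the polygon is cut off at distance
  \<open>1/2\<close>; around each lies a sector of half-width \<open>pi / 3\<close>. The potential grows at the rate
  \<open>kap\<close> outside these sectors and like the area below the chord inside of them, but it jumps down by
  \<open>exc\<close> at each point of \<open>T\<close>. These jumps make up for the \<open>k - 2\<close> in place of
  \<open>k\<close> edges that may each exceed the increase of the potential by \<open>exc\<close>.
\<close>

definition clamp :: "real \<Rightarrow> real" where "clamp t = max (-(pi/3)) (min (pi/3) t)"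

definition sector_fun :: "real \<Rightarrow> real" where
  "sector_fun t = tan (clamp t) / 8 - kap * clamp t - (if 0 \<le> t then exc else 0)"

definition potential :: "real set \<Rightarrow> real \<Rightarrow> real" where
  "potential T x = kap * x + (\<Sum>t\<in>T. sector_fun (x - t))"

text \<open>This spacing makes the sectors of half-width \<open>pi / 3\<close> around distinct
  points of \<open>T\<close> meet at most in an endpoint.\<close>

definition separated :: "real set \<Rightarrow> bool" where
  "separated T \<longleftrightarrow> finite T \<and> (\<forall>t\<in>T. \<forall>t'\<in>T. t \<noteq> t' \<longrightarrow> 2*pi/3 \<le> \<bar>t - t'\<bar>)"

lemma separatedD: "separated T \<Longrightarrow> t \<in> T \<Longrightarrow> t' \<in> T \<Longrightarrow> t' \<noteq> t \<Longrightarrow> 2*pi/3 \<le> \<bar>t - t'\<bar>"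
  unfolding separated_def by (metis abs_minus_commute)

lemma sector_fun_low: "t \<le> -(pi/3) \<Longrightarrow> sector_fun t = - sqrt 3 / 8 + kap * pi / 3"
proof -
  assume "t \<le> -(pi/3)"
  moreover have "- (pi/3) < (0::real)" by simp
  ultimately have c: "clamp t = - (pi/3)" and "\<not> 0 \<le> t" unfolding clamp_def by linarith+
  then show ?thesis unfolding sector_fun_def c by (simp add: tan_60)
qed

lemma sector_fun_high: "pi/3 \<le> t \<Longrightarrow> sector_fun t = sqrt 3 / 8 - kap * pi / 3 - exc"
proof -
  assume "pi/3 \<le> t"
  moreover have "0 < pi/3" by simp
  ultimately have c: "clamp t = pi/3" and "0 \<le> t" unfolding clamp_def by linarith+
  then show ?thesis unfolding sector_fun_def c by (simp add: tan_60)
qed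

lemma sector_fun_mid:
  "\<bar>t\<bar> \<le> pi/3 \<Longrightarrow> sector_fun t = tan t / 8 - kap * t - (if 0 \<le> t then exc else 0)"
proof -
  assume "\<bar>t\<bar> \<le> pi/3"
  then have "clamp t = t" unfolding clamp_def by linarith
  then show ?thesis unfolding sector_fun_def by simp
qed

lemma potential_diff:
  "potential T b - potential T a
     = kap * (b - a) + (\<Sum>t\<in>T. sector_fun (b - t) - sector_fun (a - t))"
  by (simp add: potential_def sum_subtractf algebra_simps)

lemma sector_fun_const:
  assumes "a \<le> b" "b \<le> t - pi/3 \<or> t + pi/3 \<le> a"
  shows "sector_fun (b - t) = sector_fun (a - t)"
  using assms by (auto simp: sector_fun_low sector_fun_high)

lemma potential_diff_gap:
  assumes "a \<le> b" "\<And>t. t \<in> T \<Longrightarrow> b \<le> t - pi/3 \<or> t + pi/3 \<le> a"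
  shows "potential T b - potential T a = kap * (b - a)"
  using assms by (simp add: potential_diff sector_fun_const)

lemma potential_diff_sector:
  assumes T: "separated T" "t \<in> T" and ab: "t - pi/3 \<le> a" "a \<le> b" "b \<le> t + pi/3"
  shows "potential T b - potential T a
    = (tan (b - t) - tan (a - t)) / 8 - (if a < t \<and> t \<le> b then exc else 0)"
proof -
  have "sector_fun (b - t') - sector_fun (a - t') = 0" if "t' \<in> T - {t}" for t'
  proof -
    have "2*pi/3 \<le> \<bar>t - t'\<bar>" using separatedD T that by simp
    then have "b \<le> t' - pi/3 \<or> t' + pi/3 \<le> a" using ab by linarith
    then show ?thesis using ab sector_fun_const[of a b t'] by simp
  qed
  then have "(\<Sum>t\<in>T. sector_fun (b - t) - sector_fun (a - t)) = sector_fun (b - t) - sector_fun (a - t)"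
    using T by (subst sum.remove[of T t]) (auto simp: separated_def)
  moreover have "\<bar>b - t\<bar> \<le> pi/3" "\<bar>a - t\<bar> \<le> pi/3" using ab by linarith+
  ultimately show ?thesis
    using ab by (auto simp: potential_diff sector_fun_mid algebra_simps)
qed

text \<open>Moves from direction \<open>x\<close> to the far end \<open>x + s\<close> of its sector.
  The point at \<open>x\<close> is cut off by the chord, so \<open>rho\<close> is at most the radius
  of the chord there; \<open>j\<close> records whether the midpoint, and with it a jump, is passed.
  Outside all sectors \<open>s = 0\<close> and \<open>chord_rad 0 = 1\<close>.\<close>

lemma sector_exit:
  assumes T: "separated T" and rho: "0 \<le> rho" "rho \<le> 1" "\<And>t. t \<in> T \<Longrightarrow> rho * cos (x - t) \<le> 1/2"
  obtains s j where "0 \<le> s" "s \<le> 2*pi/3" "rho \<le> chord_rad s"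
    "j \<in> {0,1}" "j = 1 \<longrightarrow> pi/3 \<le> s"
    "potential T (x + s) - potential T x = tri_area s - j * exc"
    "\<And>t. t \<in> T \<Longrightarrow> x + s \<le> t - pi/3 \<or> t + pi/3 \<le> x + s"
    "s = 0 \<or> (\<exists>t\<in>T. t - pi/3 \<le> x \<and> x + s = t + pi/3)"
proof (cases "\<exists>t\<in>T. t - pi/3 \<le> x \<and> x < t + pi/3")
  case True
  then obtain t where t: "t \<in> T" "t - pi/3 \<le> x" "x < t + pi/3" by auto
  define s where "s = t + pi/3 - x"
  define j :: real where "j = (if x < t then 1 else 0)"
  have s: "0 \<le> s" "s \<le> 2*pi/3" using t by (auto simp: s_def)
  show thesis
  proof (rule that[of s j])
    have "cos (pi/3 - s) \<ge> 1/2" using s by (intro cos_ge_half abs_leI) auto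
    moreover have "rho * cos (pi/3 - s) \<le> 1/2" using rho(3)[OF t(1)] by (simp add: s_def)
    ultimately show "rho \<le> chord_rad s" by (simp add: chord_rad_def field_simps)
    show "j \<in> {0,1}" "j = 1 \<longrightarrow> pi/3 \<le> s" by (auto simp: j_def s_def)
    have "potential T (x + s) - potential T x
        = (tan (x + s - t) - tan (x - t)) / 8 - (if x < t \<and> t \<le> x + s then exc else 0)"
      using t s by (intro potential_diff_sector[OF T]) (auto simp: s_def)
    moreover have "x + s - t = pi/3" "x - t = pi/3 - s" "t \<le> x + s" by (auto simp: s_def)
    ultimately show "potential T (x + s) - potential T x = tri_area s - j * exc"
      using s by (simp add: tri_area_tan tan_60 j_def)
    show "x + s \<le> t' - pi/3 \<or> t' + pi/3 \<le> x + s" if "t' \<in> T" for t'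
    proof (cases "t' = t")
      case False
      then have "2*pi/3 \<le> \<bar>t - t'\<bar>" using separatedD T t that by simp
      then show ?thesis unfolding s_def by linarith
    qed (simp add: s_def)
    show "s = 0 \<or> (\<exists>t\<in>T. t - pi/3 \<le> x \<and> x + s = t + pi/3)" using t by (auto simp: s_def)
  qed (use s in auto)
next
  case False
  show thesis
    by (rule that[of 0 0]) (use False rho in \<open>auto simp: chord_rad_zero tri_area_def not_le\<close>)
qed

lemma sector_enter:
  assumes T: "separated T" and rho: "0 \<le> rho" "rho \<le> 1" "\<And>t. t \<in> T \<Longrightarrow> rho * cos (x - t) \<le> 1/2"
  obtains s j where "0 \<le> s" "s \<le> 2*pi/3" "rho \<le> chord_rad s"
    "j \<in> {0,1}" "j = 1 \<longrightarrow> pi/3 \<le> s"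
    "potential T x - potential T (x - s) = tri_area s - j * exc"
    "\<And>t. t \<in> T \<Longrightarrow> x - s \<le> t - pi/3 \<or> t + pi/3 \<le> x - s"
    "s = 0 \<or> (\<exists>t\<in>T. x \<le> t + pi/3 \<and> x - s = t - pi/3)"
proof (cases "\<exists>t\<in>T. t - pi/3 < x \<and> x \<le> t + pi/3")
  case True
  then obtain t where t: "t \<in> T" "t - pi/3 < x" "x \<le> t + pi/3" by auto
  define s where "s = x - (t - pi/3)"
  \<comment> \<open>Unlike in \<open>sector_exit\<close>, \<open>x = t\<close> counts as passed: the
    potential has already jumped at \<open>t\<close>, so the jump belongs to the edge ending
    there.\<close>
  define j :: real where "j = (if t \<le> x then 1 else 0)"
  have s: "0 \<le> s" "s \<le> 2*pi/3" using t by (auto simp: s_def)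
  show thesis
  proof (rule that[of s j])
    have "cos (pi/3 - s) \<ge> 1/2" using s by (intro cos_ge_half abs_leI) auto
    moreover have "rho * cos (pi/3 - s) \<le> 1/2"
      using rho(3)[OF t(1)] cos_minus[of "x - t"] by (simp add: s_def)
    ultimately show "rho \<le> chord_rad s" by (simp add: chord_rad_def field_simps)
    show "j \<in> {0,1}" "j = 1 \<longrightarrow> pi/3 \<le> s" by (auto simp: j_def s_def)
    have "potential T x - potential T (x - s)
        = (tan (x - t) - tan (x - s - t)) / 8 - (if x - s < t \<and> t \<le> x then exc else 0)"
      using t s by (intro potential_diff_sector[OF T]) (auto simp: s_def)
    moreover have "x - s - t = - (pi/3)" "x - t = - (pi/3 - s)" "x - s < t" by (auto simp: s_def)
    ultimately show "potential T x - potential T (x - s) = tri_area s - j * exc"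
      using s by (simp only: tan_minus tri_area_tan) (simp add: tan_60 j_def)
    show "x - s \<le> t' - pi/3 \<or> t' + pi/3 \<le> x - s" if "t' \<in> T" for t'
    proof (cases "t' = t")
      case False
      then have "2*pi/3 \<le> \<bar>t - t'\<bar>" using separatedD T t that by simp
      then show ?thesis unfolding s_def by linarith
    qed (simp add: s_def)
    show "s = 0 \<or> (\<exists>t\<in>T. x \<le> t + pi/3 \<and> x - s = t - pi/3)" using t by (auto simp: s_def)
  qed (use s in auto)
next
  case False
  show thesis
    by (rule that[of 0 0]) (use False rho in \<open>auto simp: chord_rad_zero tri_area_def not_le\<close>)
qed

text \<open>A jump is met only after half a chord, whose area \<open>sqrt 3 / 8\<close> outweighs
  \<open>exc\<close>.\<close>

lemma tri_area_jump_nonneg: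
  assumes "0 \<le> s" "s \<le> 2*pi/3" "j \<in> {0,1}" "j = 1 \<longrightarrow> pi/3 \<le> s"
  shows "0 \<le> tri_area s - j * exc"
proof (cases "j = 1")
  case True
  then show ?thesis using tri_area_ge[of s] assms exc_le sqrt3_bounds by auto
qed (use assms tri_area_nonneg[of s] in auto)

text \<open>The tangent of the angle measures lengths on the chord.\<close>
lemma edge_same_sector:
  assumes T: "separated T" "t \<in> T" and xy: "t - pi/3 \<le> x" "x \<le> y" "y \<le> t + pi/3"
    and rho: "0 \<le> r1" "0 \<le> r2" "r1 * cos (x - t) \<le> 1/2" "r2 * cos (y - t) \<le> 1/2"
  shows "r1 * r2 * sin (y - x) / 2 \<le> exc + (potential T y - potential T x)"
proof -
  have c: "cos (x - t) \<ge> 1/2" "cos (y - t) \<ge> 1/2" 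
    using xy by (intro cos_ge_half abs_leI; linarith)+
  have "0 \<le> sin (y - x)" using xy by (intro sin_ge_zero) auto
  then have "(r1 * cos (x - t)) * (r2 * cos (y - t)) * sin (y - x) \<le> (1/2) * (1/2) * sin (y - x)"
    using rho c by (intro mult_right_mono mult_mono) auto
  moreover have "sin (y - x) = (tan (y - t) - tan (x - t)) * (cos (x - t) * cos (y - t))"
  proof -
    have "sin (y - x) = sin ((y - t) - (x - t))" by simp
    also have "\<dots> = (tan (y - t) - tan (x - t)) * (cos (x - t) * cos (y - t))"
      using c by (subst sin_diff) (auto simp: tan_def field_simps)
    finally show ?thesis .
  qed
  ultimately have "(r1 * r2 * sin (y - x)) * (cos (x - t) * cos (y - t))
      \<le> ((tan (y - t) - tan (x - t)) / 4) * (cos (x - t) * cos (y - t))"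
    by (simp add: mult_ac)
  moreover have "0 < cos (x - t) * cos (y - t)" using c by (intro mult_pos_pos) linarith+
  ultimately have "r1 * r2 * sin (y - x) \<le> (tan (y - t) - tan (x - t)) / 4"
    by (simp only: mult_le_cancel_right_pos)
  moreover have "(if x < t \<and> t \<le> y then exc else 0) \<le> exc" using exc_nonneg by simp
  ultimately show ?thesis using potential_diff_sector[OF T xy] by linarith
qed

text \<open>Three cases: both ends lie in one sector; or a whole sector lies between them, whose
  gain \<open>sqrt 3 / 4 - exc\<close> suffices; or else the radii are enlarged to those of the
  chords bounding a gap, and \<open>gap_ineq\<close> applies.\<close>

lemma edge_bound:
  assumes T: "separated T" and xy: "x \<le> y" "y < x + pi"
    and r1: "0 \<le> r1" "r1 \<le> 1" "\<And>t. t \<in> T \<Longrightarrow> r1 * cos (x - t) \<le> 1/2"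
    and r2: "0 \<le> r2" "r2 \<le> 1" "\<And>t. t \<in> T \<Longrightarrow> r2 * cos (y - t) \<le> 1/2"
  shows "r1 * r2 * sin (y - x) / 2 \<le> exc + (potential T y - potential T x)"
proof (cases "\<exists>t\<in>T. t - pi/3 \<le> x \<and> y \<le> t + pi/3")
  case True
  then show ?thesis using edge_same_sector[OF T] xy r1 r2 by blast
next
  case False
  obtain s j where s: "0 \<le> s" "s \<le> 2*pi/3" "r1 \<le> chord_rad s" and j: "j \<in> {0,1}" "j = 1 \<longrightarrow> pi/3 \<le> s"
    and Ms: "potential T (x + s) - potential T x = tri_area s - j * exc"
    and outs: "\<And>t. t \<in> T \<Longrightarrow> x + s \<le> t - pi/3 \<or> t + pi/3 \<le> x + s"
    and ss: "s = 0 \<or> (\<exists>t\<in>T. t - pi/3 \<le> x \<and> x + s = t + pi/3)"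
    using sector_exit[OF T r1] by blast
  obtain s' j' where s': "0 \<le> s'" "s' \<le> 2*pi/3" "r2 \<le> chord_rad s'" and j': "j' \<in> {0,1}" "j' = 1 \<longrightarrow> pi/3 \<le> s'"
    and Ms': "potential T y - potential T (y - s') = tri_area s' - j' * exc"
    and outs': "\<And>t. t \<in> T \<Longrightarrow> y - s' \<le> t - pi/3 \<or> t + pi/3 \<le> y - s'"
    and ss': "s' = 0 \<or> (\<exists>t\<in>T. y \<le> t + pi/3 \<and> y - s' = t - pi/3)"
    using sector_enter[OF T r2] by blast
  have e1: "x + s < y \<or> s = 0" using ss False by force
  \<comment> \<open>The point \<open>x + s\<close> is not inside the sector entered at
    \<open>y - s'\<close> and lies before its far end, hence before its near end.\<close>
  have le: "x + s \<le> y - s'"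
  proof (cases "s' = 0")
    case True
    then show ?thesis using e1 xy by auto
  next
    case False
    then obtain t where t: "t \<in> T" "y \<le> t + pi/3" "y - s' = t - pi/3" using ss' by blast
    have "x < t - pi/3" using t \<open>\<not> (\<exists>t\<in>T. t - pi/3 \<le> x \<and> y \<le> t + pi/3)\<close> by force
    then have "x + s < t + pi/3" using t e1 pi_gt_zero by linarith
    then show ?thesis using outs[OF t(1)] t by linarith
  qed
  define u where "u = y - s' - (x + s)"
  have u: "0 \<le> u" "s + u + s' = y - x" using le by (auto simp: u_def)
  have tot: "potential T y - potential T x = (tri_area s - j * exc) + (tri_area s' - j' * exc)
      + (potential T (y - s') - potential T (x + s))" using Ms Ms' by simp
  have sn: "0 \<le> sin (y - x)" using xy by (intro sin_ge_zero) auto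
  show ?thesis
  proof (cases "\<exists>t\<in>T. x + s \<le> t - pi/3 \<and> t + pi/3 \<le> y - s'")
    case True
    then obtain t where t: "t \<in> T" "x + s \<le> t - pi/3" "t + pi/3 \<le> y - s'" by auto
    have sep: "2*pi/3 \<le> \<bar>t - t'\<bar>" if "t' \<in> T" "t' \<noteq> t" for t'
      using separatedD T t that by simp
    have "potential T (t - pi/3) - potential T (x + s) = kap * ((t - pi/3) - (x + s))"
    proof (rule potential_diff_gap)
      fix t' assume "t' \<in> T"
      then show "t - pi/3 \<le> t' - pi/3 \<or> t' + pi/3 \<le> x + s"
      proof (cases "t' = t")
        case False
        have "x + s \<le> t' - pi/3 \<or> t' + pi/3 \<le> x + s" using outs \<open>t' \<in> T\<close> .
        moreover have "t' \<le> t - 2*pi/3 \<or> t + 2*pi/3 \<le> t'" using sep[OF \<open>t' \<in> T\<close> False] by linarith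
        \<comment> \<open>A second sector in between would force
          \<open>y - x >= 4 * pi / 3\<close>.\<close>
        moreover have "\<not> (x + s \<le> t' - pi/3 \<and> t' \<le> t - 2*pi/3)" using t xy s s' by linarith
        moreover have "t - pi/3 \<le> t' - pi/3" if "t + 2*pi/3 \<le> t'" using that pi_gt_zero by linarith
        ultimately show ?thesis by blast
      qed simp
    qed (use t in auto)
    moreover have "potential T (y - s') - potential T (t + pi/3) = kap * ((y - s') - (t + pi/3))"
    proof (rule potential_diff_gap)
      fix t' assume "t' \<in> T"
      then show "y - s' \<le> t' - pi/3 \<or> t' + pi/3 \<le> t + pi/3"
      proof (cases "t' = t")
        case False
        have "y - s' \<le> t' - pi/3 \<or> t' + pi/3 \<le> y - s'" using outs' \<open>t' \<in> T\<close> .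
        moreover have "t' \<le> t - 2*pi/3 \<or> t + 2*pi/3 \<le> t'" using sep[OF \<open>t' \<in> T\<close> False] by linarith
        moreover have "\<not> (t' + pi/3 \<le> y - s' \<and> t + 2*pi/3 \<le> t')" using t xy s s' by linarith
        moreover have "t' + pi/3 \<le> t + pi/3" if "t' \<le> t - 2*pi/3" using that pi_gt_zero by linarith
        ultimately show ?thesis by blast
      qed simp
    qed (use t in auto)
    moreover have "potential T (t + pi/3) - potential T (t - pi/3) = sqrt 3 / 4 - exc"
      using potential_diff_sector[OF T t(1), of "t - pi/3" "t + pi/3"] by (simp add: tan_60)
    moreover have "0 \<le> kap * ((t - pi/3) - (x + s))" "0 \<le> kap * ((y - s') - (t + pi/3))"
      using t kap_pos by auto
    ultimately have M: "potential T y - potential T x \<ge> sqrt 3 / 4 - exc"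
      using tot tri_area_jump_nonneg[OF s(1,2) j] tri_area_jump_nonneg[OF s'(1,2) j'] by linarith
    \<comment> \<open>The passed sector alone gives \<open>y - x >= 2 * pi / 3\<close>.\<close>
    have "sin (y - x) = sin (pi - (y - x))" by simp
    also have "\<dots> \<le> sin (pi/3)" using xy t s s' by (intro sin_monotone_2pi_le) auto
    finally have "sin (y - x) \<le> sqrt 3 / 2" by (simp add: sin_60)
    moreover have "r1 * r2 * sin (y - x) \<le> 1 * sin (y - x)"
      using r1 r2 sn by (intro mult_right_mono mult_le_one) auto
    ultimately show ?thesis using M by simp
  next
    case False
    have "potential T (y - s') - potential T (x + s) = kap * u"
      unfolding u_def
    proof (rule potential_diff_gap[OF le])
      fix t assume "t \<in> T"
      then show "y - s' \<le> t - pi/3 \<or> t + pi/3 \<le> x + s"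
        using False outs[of t] outs'[of t] by force
    qed
    moreover have "r1 * r2 * sin (y - x) \<le> chord_rad s * chord_rad s' * sin (y - x)"
      using r1 r2 s s' sn chord_rad_bounds by (intro mult_right_mono mult_mono) (auto intro: order_trans)
    moreover have "chord_rad s * chord_rad s' * sin (s + u + s') / 2
      \<le> exc * (1 - j - j') + tri_area s + tri_area s' + kap * u"
      using u xy by (intro gap_ineq s s' j j') auto
    moreover have "exc * (1 - j - j') = exc - j * exc - j' * exc" by (simp add: algebra_simps)
    ultimately show ?thesis unfolding u(2) using tot by linarith
  qed
qed

section \<open>Polygons in polar coordinates\<close>

definition pol :: "real \<Rightarrow> real^2" where "pol t = vector [cos t, sin t]"

lemma pol_nth [simp]: "pol t $ 1 = cos t" "pol t $ 2 = sin t"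
  by (simp_all add: pol_def)

lemma inner_2: "(x::real^2) \<bullet> y = x $ 1 * y $ 1 + x $ 2 * y $ 2"
  by (simp add: inner_vec_def sum_2)

lemma vec2_eq_iff: "(x::real^2) = y \<longleftrightarrow> x $ 1 = y $ 1 \<and> x $ 2 = y $ 2"
  by (simp add: vec_eq_iff forall_2)

lemma norm_2: "norm (x::real^2) = sqrt ((x $ 1)\<^sup>2 + (x $ 2)\<^sup>2)"
  by (simp add: norm_eq_sqrt_inner inner_2 power2_eq_square)

lemma inner_pol: "pol a \<bullet> pol b = cos (a - b)"
  by (simp add: inner_2 cos_diff)

lemma norm_pol [simp]: "norm (pol t) = 1"
  by (simp add: norm_2)

lemma pol_nonzero [simp]: "pol t \<noteq> 0"
  using norm_pol[of t] by force

lemma pol_periodic: "pol (t + 2 * pi) = pol t"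
  by (simp add: vec2_eq_iff)

lemma polar_form:
  fixes x :: "real^2"
  assumes "0 \<le> t0" "t0 < 2*pi"
  obtains t where "t0 \<le> t" "t < t0 + 2*pi" "x = norm x *\<^sub>R pol t"
proof (cases "x = 0")
  case True
  then show ?thesis using that[of t0] by auto
next
  case False
  have sq: "(norm x)\<^sup>2 = (x $ 1)\<^sup>2 + (x $ 2)\<^sup>2" by (simp add: norm_2)
  have "(x $ 1 / norm x)\<^sup>2 + (x $ 2 / norm x)\<^sup>2 = 1"
    using False unfolding power_divide by (simp only: sq[symmetric] flip: add_divide_distrib) simp
  then obtain t where t: "0 \<le> t" "t < 2*pi" "x $ 1 / norm x = cos t" "x $ 2 / norm x = sin t"
    by (rule sincos_total_2pi)
  have x: "x = norm x *\<^sub>R pol t" using False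
    unfolding vec2_eq_iff vector_scaleR_component pol_nth t(3,4)[symmetric] by simp
  show ?thesis
  proof (cases "t0 \<le> t")
    case True
    show ?thesis by (rule that[OF True _ x]) (use t assms in linarith)
  next
    case False
    have "x = norm x *\<^sub>R pol (t + 2*pi)" unfolding pol_periodic by (rule x)
    then show ?thesis using False t assms by (intro that[of "t + 2*pi"]) linarith+
  qed
qed

section \<open>Triangulating a convex polygon from an interior point\<close>

lemma pol_between:
  assumes "a < c" "c < a + pi"
  shows "pol b = (sin (c - b) / sin (c - a)) *\<^sub>R pol a + (sin (b - a) / sin (c - a)) *\<^sub>R pol c"
proof -
  \<comment> \<open>The coefficients come from Cramer's rule; \<open>sin (c - a)\<close> is the
    determinant of \<open>pol a\<close> and \<open>pol c\<close>.\<close>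
  have "sin (c - a) > 0" using assms by (intro sin_gt_zero) auto
  moreover have "sin (c - b) * cos a + sin (b - a) * cos c = sin (c - a) * cos b"
    "sin (c - b) * sin a + sin (b - a) * sin c = sin (c - a) * sin b"
    by (simp_all add: sin_diff algebra_simps)
  ultimately show ?thesis by (simp add: vec2_eq_iff field_simps)
qed

text \<open>If \<open>a + b < 1\<close>, then \<open>x\<close> lies strictly between 0 and a point
  of \<open>V\<close> on the segment from \<open>y\<close> to \<open>z\<close>.\<close>

lemma extreme_point_scaled_comb:
  fixes V :: "'a::euclidean_space set"
  assumes V: "convex V" "0 \<in> V" "y \<in> V" "z \<in> V" and x: "x extreme_point_of V" "x \<noteq> 0"
    and eq: "x = a *\<^sub>R y + b *\<^sub>R z" and ab: "0 \<le> a" "0 \<le> b"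
  shows "1 \<le> a + b"
proof (rule ccontr)
  assume "\<not> 1 \<le> a + b"
  then have lt: "a + b < 1" by simp
  have pos: "0 < a + b"
  proof (rule ccontr)
    assume "\<not> 0 < a + b"
    then have "a = 0" "b = 0" using ab by auto
    then show False using x eq by simp
  qed
  define w where "w = (a / (a + b)) *\<^sub>R y + (b / (a + b)) *\<^sub>R z"
  have "w \<in> V" unfolding w_def
    using V pos ab by (intro convexD) (auto simp flip: add_divide_distrib)
  moreover have xw: "x = (a + b) *\<^sub>R w" using pos unfolding w_def eq by (simp add: scaleR_add_right)
  moreover have "w \<noteq> 0" using xw x by auto
  then have "x \<in> open_segment 0 w"
    using pos lt xw by (auto simp: in_segment intro!: exI[of _ "a + b"])
  ultimately show False using x V unfolding extreme_point_of_def by blast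
qed

text \<open>Since \<open>x\<close> lies in the cone of \<open>y\<close> and \<open>z\<close>, it is
  \<open>p *\<^sub>R y + q *\<^sub>R z\<close> with \<open>p + q >= 1\<close> by extremality. This
  forces \<open>l x > 1\<close>.\<close>

lemma fan_step:
  assumes V: "convex V" "0 \<in> V" "y \<in> V" "z \<in> V" and x: "x extreme_point_of V" "x \<noteq> 0"
    and l: "linear l" "l x = 1" "1 < l y" "1 < (l z :: real)"
    and form: "y = ry *\<^sub>R pol a" "x = rx *\<^sub>R pol b" "z = rz *\<^sub>R pol c" "0 < ry" "0 \<le> rx" "0 < rz"
    and ang: "a \<le> b" "b \<le> c" "a < c" "c < a + pi"
  shows False
proof -
  define p q where "p = rx * sin (c - b) / (ry * sin (c - a))" and "q = rx * sin (b - a) / (rz * sin (c - a))"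
  have "sin (c - a) > 0" "sin (c - b) \<ge> 0" "sin (b - a) \<ge> 0"
    using ang by (auto intro!: sin_gt_zero sin_ge_zero)
  then have pq: "0 \<le> p" "0 \<le> q" using form by (auto simp: p_def q_def)
  have eq: "x = p *\<^sub>R y + q *\<^sub>R z"
    unfolding form(1-3) pol_between[OF ang(3,4), of b] using form(4-6)
    by (simp add: p_def q_def scaleR_add_right)
  have "1 \<le> p + q" by (rule extreme_point_scaled_comb[OF V x eq pq])
  moreover have "1 = p * l y + q * l z" using l eq by (simp add: linear_add linear_scale)
  moreover have "p * 1 \<le> p * l y" "q * 1 \<le> q * l z" using pq l by (intro mult_left_mono; simp)+
  moreover have "p * 1 < p * l y \<or> q * 1 < q * l z"
  proof (cases "p = 0")
    case True
    then have "0 < q" using \<open>1 \<le> p + q\<close> by simp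
    then have "q * 1 < q * l z" using l by (intro mult_strict_left_mono) auto
    then show ?thesis ..
  next
    case False
    then have "p * 1 < p * l y" using l pq by (intro mult_strict_left_mono) auto
    then show ?thesis ..
  qed
  ultimately show False by linarith
qed

lemma partition_index:
  fixes ph :: "nat \<Rightarrow> real"
  assumes "ph 0 \<le> x" "x < ph n"
  obtains i where "i < n" "ph i \<le> x" "x < ph (Suc i)"
proof -
  define m where "m = (LEAST m. x < ph m)"
  have m: "x < ph m" unfolding m_def using assms(2) by (rule LeastI)
  have "m \<le> n" unfolding m_def using assms(2) by (rule Least_le)
  moreover have "m \<noteq> 0" using m assms by (intro notI) auto
  then obtain i where i: "m = Suc i" by (cases m) auto
  moreover have "\<not> x < ph i" using i unfolding m_def by (intro not_less_Least) simp
  ultimately show ?thesis using that[of i] m by auto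
qed

text \<open>\<open>ph n\<close> is \<open>ph 0\<close> after a full turn, so \<open>x n = x 0\<close>.\<close>

locale fan =
  fixes V :: "(real^2) set" and n :: nat and ph :: "nat \<Rightarrow> real" and x :: "nat \<Rightarrow> real^2"
    and R :: "nat \<Rightarrow> real"
  assumes convex: "convex V" and interior: "0 \<in> interior V"
    and ph0: "0 \<le> ph 0" "ph 0 < 2*pi" and ph_n: "ph n = ph 0 + 2*pi"
    and mono: "\<And>i j. i < j \<Longrightarrow> j \<le> n \<Longrightarrow> ph i < ph j"
    and x: "\<And>i. x i = R i *\<^sub>R pol (ph i)" and Rpos: "\<And>i. i \<le> n \<Longrightarrow> 0 < R i"
    and hull: "V = convex hull (x ` {..<n})"
    and extreme: "\<And>i. i \<le> n \<Longrightarrow> x i extreme_point_of V"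
begin

lemma zero_in: "0 \<in> V" using interior interior_subset by auto

lemma x_in: "i \<le> n \<Longrightarrow> x i \<in> V" using extreme by (auto simp: extreme_point_of_def)

text \<open>A gap of at least \<open>pi\<close> would leave all vertices in a closed half plane
  bounded by a line through 0, although 0 is an interior point.\<close>

lemma gap:
  assumes i: "i < n"
  shows "ph (Suc i) < ph i + pi"
proof (rule ccontr)
  assume big: "\<not> ph (Suc i) < ph i + pi"
  \<comment> \<open>The direction opposite to the bisector of the gap; modulo \<open>2 * pi\<close>
    every vertex direction is within \<open>pi / 2\<close> of it.\<close>
  define m where "m = (ph i + ph (Suc i)) / 2 + pi"
  have "0 \<le> pol m \<bullet> x j" if j: "j < n" for j
  proof -
    have "0 \<le> cos (m - ph j)"
    proof (cases "j \<le> i")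
      case False
      have "ph (Suc i) \<le> ph j" using False j mono[of "Suc i" j] by (cases "j = Suc i") auto
      moreover have "ph j \<le> ph i + 2*pi"
        using mono[of j n] mono[of 0 i] j ph_n i by (cases "i = 0") auto
      ultimately show ?thesis unfolding m_def using big by (intro cos_ge_zero) (simp_all add: field_simps)
    next
      case True
      have "ph (Suc i) \<le> ph j + 2*pi"
      proof -
        have "ph (Suc i) \<le> ph n" using i mono[of "Suc i" n] by (cases "Suc i = n") auto
        moreover have "ph 0 \<le> ph j" using mono[of 0 j] j by (cases "j = 0") auto
        ultimately show ?thesis using ph_n by simp
      qed
      moreover have "ph j \<le> ph i" using mono[of j i] True i by (cases "j = i") auto
      ultimately have "0 \<le> cos (m - (ph j + 2*pi))"
        unfolding m_def using big by (intro cos_ge_zero) (simp_all add: field_simps)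
      moreover have "cos (m - (ph j + 2*pi)) = cos (m - ph j)"
        using cos_periodic[of "m - (ph j + 2*pi)"] by simp
      ultimately show ?thesis by simp
    qed
    then show ?thesis using Rpos[of j] j by (simp add: x inner_pol)
  qed
  then have "V \<subseteq> {z. 0 \<le> pol m \<bullet> z}"
    unfolding hull by (intro hull_minimal convex_halfspace_ge) auto
  moreover obtain e where e: "e > 0" "cball 0 e \<subseteq> V"
    using interior by (auto simp: mem_interior_cball)
  moreover have "- e *\<^sub>R pol m \<in> cball 0 e" using e by simp
  ultimately have "0 \<le> pol m \<bullet> (- e *\<^sub>R pol m)" by blast
  then show False using e by (simp add: inner_pol)
qed

text \<open>If \<open>y\<close> lay beyond the line through \<open>x i\<close> and
  \<open>x (Suc i)\<close>, so would some vertex \<open>x j\<close>. Then one of \<open>x i\<close>,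
  \<open>x (Suc i)\<close> lies in the cone of \<open>y\<close> and \<open>x j\<close>, which
  \<open>fan_step\<close> excludes; the remaining positions of \<open>x j\<close> contradict
  linearity.\<close>

lemma cover:
  assumes y: "y \<in> V"
  obtains i where "i < n" "y \<in> convex hull {0, x i, x (Suc i)}"
proof -
  obtain a where a: "ph 0 \<le> a" "a < ph 0 + 2*pi" "y = norm y *\<^sub>R pol a"
    by (rule polar_form[OF ph0])
  then obtain i where i: "i < n" "ph i \<le> a" "a < ph (Suc i)"
    using partition_index[of ph a n] ph_n by auto
  show ?thesis
  proof (cases "y = 0")
    case True
    then show ?thesis using that[OF i(1)] by (auto intro: hull_inc)
  next
    case False
    let ?b = "ph i" and ?c = "ph (Suc i)"
    have bc: "?b < ?c" "?c < ?b + pi" using i gap mono by auto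
    have spos: "0 < sin (?c - ?b)" using bc by (intro sin_gt_zero) auto
    have Rp: "0 < R i" "0 < R (Suc i)" using Rpos i by auto
    define dt where "dt = (\<lambda>(u :: real^2) (v :: real^2). u $ 1 * v $ 2 - u $ 2 * v $ 1)"
    have dpol: "dt (pol u) (pol v) = sin (v - u)" for u v by (simp add: dt_def sin_diff)
    have dsc: "dt (r *\<^sub>R u) (s *\<^sub>R v) = r * s * dt u v" for r s u v by (simp add: dt_def algebra_simps)
    define D where "D = dt (x i) (x (Suc i))"
    have D: "0 < D" using spos Rp by (simp add: D_def x dsc dpol)
    \<comment> \<open>By Cramer's rule, the linear function with value 1 at both \<open>x i\<close>
      and \<open>x (Suc i)\<close>; \<open>dt\<close> is the determinant.\<close>
    define l where "l = (\<lambda>z. (dt z (x (Suc i)) + dt (x i) z) / D)"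
    have lin: "linear l" unfolding l_def dt_def using D
      by (intro linearI) (simp_all add: field_simps)
    have lx: "l (x i) = 1" "l (x (Suc i)) = 1" using D by (auto simp: l_def D_def dt_def)
    define p q where "p = norm y * sin (?c - a) / (R i * sin (?c - ?b))"
      and "q = norm y * sin (a - ?b) / (R (Suc i) * sin (?c - ?b))"
    have "sin (?c - a) \<ge> 0" "sin (a - ?b) \<ge> 0" using bc i by (auto intro!: sin_ge_zero)
    then have pq: "0 \<le> p" "0 \<le> q" using spos Rp by (auto simp: p_def q_def)
    have ypq: "y = p *\<^sub>R x i + q *\<^sub>R x (Suc i)"
      using Rp by (subst a(3), subst pol_between[OF bc, of a])
        (simp add: p_def q_def x scaleR_add_right)
    have ly: "l y = p + q" using lin lx by (subst ypq) (simp add: linear_add linear_scale)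
    have "p + q \<le> 1"
    proof (rule ccontr)
      assume "\<not> p + q \<le> 1"
      then have ly1: "1 < l y" using ly by simp
      have "\<exists>j<n. 1 < l (x j)"
      proof (rule ccontr)
        assume "\<not> (\<exists>j<n. 1 < l (x j))"
        then have "x ` {..<n} \<subseteq> l -` {..1}" by force
        then have "V \<subseteq> l -` {..1}" unfolding hull
          by (intro hull_minimal convex_linear_vimage[OF lin]) auto
        then show False using y ly1 by auto
      qed
      then obtain j where j: "j < n" "1 < l (x j)" by auto
      have ny: "0 < norm y" using False by simp
      have Rj: "0 < R j" using Rpos j by simp
      have jcase: "ph j \<le> ?b \<or> ?c \<le> ph j"
        using mono[of j i] mono[of "Suc i" j] i j by (cases "j \<le> i"; cases "j = i"; cases "j = Suc i") auto
      have jr: "ph 0 \<le> ph j" "ph j < ph 0 + 2*pi" using mono[of 0 j] mono[of j n] j ph_n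
        by (cases "j = 0"; auto)+
      \<comment> \<open>Here \<open>j'\<close> is a lift of the angle of \<open>x j\<close>, and
        \<open>x (Suc i)\<close> lies between \<open>y\<close> and \<open>x j\<close>; in
        \<open>down\<close> it is \<open>x i\<close>.\<close>
      have up: False if "j' = ph j \<or> j' = ph j + 2*pi" "?c \<le> j'" "a < j'" "j' < a + pi" for j'
      proof -
        have "x j = R j *\<^sub>R pol j'" using that(1) by (auto simp: x pol_periodic)
        from fan_step[OF convex zero_in y x_in[of j] extreme[of "Suc i"] _ lin lx(2) ly1 j(2) a(3) x[of "Suc i"] this]
        show False using that i j ny Rp Rj by (auto simp: x)
      qed
      have down: False if "ph j = j' \<or> ph j = j' + 2*pi" "j' \<le> ?b" "j' < a" "a < j' + pi" for j'
      proof -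
        have "x j = R j *\<^sub>R pol j'" using that(1) by (auto simp: x pol_periodic)
        from fan_step[OF convex zero_in x_in[of j] y extreme[of i] _ lin lx(1) j(2) ly1 this x[of i] a(3)]
        show False using that i j ny Rp Rj by (auto simp: x)
      qed
      \<comment> \<open>On opposite rays from 0 the linear function \<open>l\<close> has opposite
        signs.\<close>
      have opp: False if "\<bar>ph j - a\<bar> = pi"
      proof -
        have "pol (ph j) = - pol a"
        proof -
          consider "ph j = a + pi" | "ph j = a - pi" using \<open>\<bar>ph j - a\<bar> = pi\<close> by linarith
          then show ?thesis by cases (auto simp: vec2_eq_iff cos_diff sin_diff)
        qed
        then have "norm y *\<^sub>R x j = - (R j) *\<^sub>R y" by (subst (2) a(3)) (simp add: x)
        then have "norm y * l (x j) = - R j * l y" using lin by (metis linear_scale real_scaleR_def)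
        moreover have "0 < norm y * l (x j)" "0 < R j * l y" using ny Rj j ly1 by auto
        ultimately show False by simp
      qed
      consider "ph j = a" | "a < ph j" "ph j < a + pi" | "ph j < a" "a - pi < ph j"
        | "\<bar>ph j - a\<bar> = pi" | "a + pi < ph j" | "ph j < a - pi" by linarith
      then show False
      proof cases
        case 1
        then have "ph j = ?b" using jcase i by auto
        then have "j = i" using mono[of j i] mono[of i j] i j by (cases j i rule: linorder_cases) auto
        then show False using lx j by simp
      next
        case 2
        then show False using up[of "ph j"] jcase i by auto
      next
        case 3
        then show False using down[of "ph j"] jcase i by auto
      next
        case 4
        then show False by (rule opp)
      next
        case 5
        have "ph 0 \<le> ?b" using mono[of 0 i] i by (cases "i = 0") auto
        then show False using 5 down[of "ph j - 2*pi"] jr a by auto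
      next
        case 6
        have "?c \<le> ph n" using mono[of "Suc i" n] i by (cases "Suc i = n") auto
        then show False using 6 up[of "ph j + 2*pi"] jr a ph_n by auto
      qed
    qed
    then have "y \<in> convex hull {0, x i, x (Suc i)}"
      unfolding convex_hull_3 mem_Collect_eq using ypq pq
      by (intro exI[of _ "1 - p - q"] exI[of _ p] exI[of _ q]) simp
    then show ?thesis using that i by blast
  qed
qed

lemma content_le:
  assumes "compact V"
  shows "measure lborel V \<le> (\<Sum>i<n. R i * R (Suc i) * sin (ph (Suc i) - ph i) / 2)"
proof -
  have cpt: "compact (convex hull {0, x i, x (Suc i)})" for i
    by (intro finite_imp_compact_convex_hull) auto
  have "measure lborel V \<le> measure lborel (\<Union>i\<in>{..<n}. convex hull {0, x i, x (Suc i)})"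
  proof (rule measure_mono_fmeasurable)
    show "V \<subseteq> (\<Union>i\<in>{..<n}. convex hull {0, x i, x (Suc i)})" using cover by blast
    show "V \<in> sets lborel" using assms by (simp add: compact_imp_closed)
    show "(\<Union>i\<in>{..<n}. convex hull {0, x i, x (Suc i)}) \<in> fmeasurable lborel"
      by (intro fmeasurable_compact compact_UN cpt) auto
  qed
  also have "\<dots> \<le> (\<Sum>i<n. measure lborel (convex hull {0, x i, x (Suc i)}))"
    by (intro measure_UNION_le) (auto intro: borel_compact cpt)
  also have "\<dots> = (\<Sum>i<n. R i * R (Suc i) * sin (ph (Suc i) - ph i) / 2)"
  proof (rule sum.cong)
    fix i assume "i \<in> {..<n}"
    then have i: "i < n" by simp
    have "0 \<le> sin (ph (Suc i) - ph i)" using gap[OF i] mono[of i "Suc i"] i by (intro sin_ge_zero) auto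
    then have p: "0 \<le> R i * R (Suc i) * sin (ph (Suc i) - ph i)"
      using Rpos[of i] Rpos[of "Suc i"] i by auto
    have "measure lborel (convex hull {0, x i, x (Suc i)}) = \<bar>- (R i * R (Suc i) * sin (ph (Suc i) - ph i))\<bar> / 2"
      unfolding content_triangle by (simp add: x sin_diff algebra_simps)
    then show "measure lborel (convex hull {0, x i, x (Suc i)}) = R i * R (Suc i) * sin (ph (Suc i) - ph i) / 2"
      using p by simp
  qed simp
  finally show ?thesis .
qed

end


text \<open>The extreme points, whose convex hull is \<open>V\<close>, are sorted by their
  angle.\<close>

lemma fan_exists:
  fixes V :: "(real^2) set"
  assumes V: "compact V" "convex V" "0 \<in> interior V" and fin: "finite {x. x extreme_point_of V}"
  obtains n ph x R where "fan V n ph x R" "n \<le> card {x. x extreme_point_of V}"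
proof -
  define X where "X = {x. x extreme_point_of V}"
  have hull: "V = convex hull X" unfolding X_def by (rule Krein_Milman_Minkowski[OF V(1,2)])
  have zV: "0 \<in> V" using V interior_subset by auto
  then have "X \<noteq> {}" using hull by auto
  have Xnz: "x \<noteq> 0" if "x \<in> X" for x
    using extreme_point_not_in_interior[of 0 V] that V unfolding X_def by auto
  have "\<exists>t. 0 \<le> t \<and> t < 2*pi \<and> x = norm x *\<^sub>R pol t" for x
    using polar_form[of 0 x] by force
  then obtain ang where ang: "\<And>x. 0 \<le> ang x" "\<And>x. ang x < 2*pi" "\<And>x. x = norm x *\<^sub>R pol (ang x)"
    by metis
  define l where "l = sorted_list_of_set (ang ` X)"
  define n where "n = length l"
  have finA: "finite (ang ` X)" using fin by (simp add: X_def)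
  have set_l: "set l = ang ` X" using finA by (simp add: l_def)
  have sl: "sorted_wrt (<) l" unfolding l_def by simp
  have n0: "0 < n" using set_l \<open>X \<noteq> {}\<close> by (auto simp: n_def)
  have "\<exists>x\<in>X. ang x = l ! i" if "i < n" for i
    using nth_mem[of i l] that set_l unfolding n_def by auto
  then obtain y where y: "\<And>i. i < n \<Longrightarrow> y i \<in> X" "\<And>i. i < n \<Longrightarrow> ang (y i) = l ! i" by metis
  define ph where "ph i = (if i < n then l ! i else l ! 0 + 2*pi)" for i
  define x where "x i = (if i < n then y i else y 0)" for i
  define R where "R i = norm (x i)" for i
  have lr: "0 \<le> l ! i" "l ! i < 2*pi" if "i < n" for i
    using y(2)[OF that] ang(1,2)[of "y i"] by auto
  \<comment> \<open>No two extreme points share a direction, since the shorter one would lie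
    strictly between 0 and the other.\<close>
  have same: "u = v" if "u \<in> X" "v \<in> X" "ang u = ang v" "norm u \<le> norm v" for u v
  proof -
    have "u = norm u *\<^sub>R pol (ang v)" using ang(3)[of u] that(3) by simp
    also have "\<dots> = (norm u / norm v) *\<^sub>R v"
      using Xnz[OF that(2)] by (subst (3) ang(3)[of v]) simp
    finally have eq: "u = (norm u / norm v) *\<^sub>R v + 0 *\<^sub>R v" by simp
    have "1 \<le> norm u / norm v + 0"
      using that Xnz V zV by (intro extreme_point_scaled_comb[OF V(2) zV _ _ _ _ eq])
        (auto simp: X_def extreme_point_of_def)
    then have "norm v \<le> norm u" using Xnz[OF that(2)] by (simp add: field_simps)
    then have "norm u / norm v = 1" using that(4) Xnz[OF that(2)]
      by (metis divide_self norm_eq_zero order_antisym)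
    then show ?thesis using eq unfolding \<open>norm u / norm v = 1\<close> by simp
  qed
  show thesis
  proof (rule that)
    show "n \<le> card {x. x extreme_point_of V}"
      using card_image_le[of X ang] fin by (simp add: n_def l_def X_def)
    show "fan V n ph x R"
    proof
      show "0 \<le> ph 0" "ph 0 < 2 * pi" "ph n = ph 0 + 2*pi" using n0 lr by (auto simp: ph_def)
      show "ph i < ph j" if "i < j" "j \<le> n" for i j
      proof (cases "j = n")
        case True
        then show ?thesis using lr[of i] lr[of 0] that n0 by (simp add: ph_def)
      next
        case False
        then show ?thesis using sorted_wrt_nth_less[OF sl, of i j] that by (simp add: ph_def n_def)
      qed
      show "x i = R i *\<^sub>R pol (ph i)" for i
        using ang(3)[of "x i"] y(2) n0 by (auto simp: x_def R_def ph_def pol_periodic)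
      show "0 < R i" if "i \<le> n" for i using Xnz y n0 by (auto simp: R_def x_def)
      show "x i extreme_point_of V" if "i \<le> n" for i
        using y(1) n0 by (auto simp: x_def X_def)
      have "X \<subseteq> x ` {..<n}"
      proof
        fix z assume z: "z \<in> X"
        then have "ang z \<in> set l" using set_l by auto
        then obtain i where i: "i < n" "ang z = l ! i" unfolding n_def by (metis in_set_conv_nth)
        then have "z = y i" using same[of z "y i"] same[of "y i" z] y[OF i(1)] z by force
        then show "z \<in> x ` {..<n}" using i by (auto simp: x_def)
      qed
      then have "x ` {..<n} = X" using y by (auto simp: x_def)
      then show "V = convex hull (x ` {..<n})" using hull by simp
    qed (use V in auto)
  qed
qed

text \<open>Three lifts of a direction suffice to represent it on every window of length \<open>2 * pi\<close>
  that contains \<open>q\<close>.\<close>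

definition turns :: "real \<Rightarrow> real set" where
  "turns q = {q - 2*pi, q, q + 2*pi}"

text \<open>The lifts are \<open>2 * pi\<close> apart, so the sum telescopes to two values of
  \<open>sector_fun\<close> beyond its sector, one on either side.\<close>

lemma sum_sector_fun_turns:
  assumes "t0 \<le> q" "q < t0 + 2*pi"
  shows "(\<Sum>t\<in>turns q. sector_fun (t0 + 2*pi - t) - sector_fun (t0 - t))
    = sqrt 3 / 4 - 2 * kap * pi / 3 - exc"
proof -
  have "(\<Sum>t\<in>turns q. sector_fun (t0 + 2*pi - t) - sector_fun (t0 - t))
    = sector_fun (t0 + 2*pi - (q - 2*pi)) - sector_fun (t0 - (q + 2*pi))"
    by (simp add: turns_def algebra_simps)
  also have "pi/3 \<le> t0 + 2*pi - (q - 2*pi)" using assms pi_gt_zero by linarith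
  from sector_fun_high[OF this]
  have "sector_fun (t0 + 2*pi - (q - 2*pi)) = sqrt 3 / 8 - kap * pi / 3 - exc" .
  also have "t0 - (q + 2*pi) \<le> - (pi/3)" using assms pi_gt_zero by linarith
  from sector_fun_low[OF this] have "sector_fun (t0 - (q + 2*pi)) = - sqrt 3 / 8 + kap * pi / 3" .
  finally show ?thesis by simp
qed

lemma cos_le_neg_half_imp:
  assumes "cos d \<le> -1/2"
  shows "2*pi/3 \<le> \<bar>d\<bar>"
proof (rule ccontr)
  assume "\<not> 2*pi/3 \<le> \<bar>d\<bar>"
  then have "cos (2*pi/3) < cos \<bar>d\<bar>" by (intro cos_monotone_0_pi) auto
  then show False using assms by (simp add: cos_120)
qed

lemma turns_cos: "t \<in> turns q \<Longrightarrow> cos (x - t) = cos (x - q)"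
proof -
  assume "t \<in> turns q"
  then consider "t = q" | "t = q + 2*pi" | "t = q - 2*pi" by (auto simp: turns_def)
  then show ?thesis
    using cos_periodic[of "x - q"] cos_periodic[of "x - q - 2*pi"] by cases (simp_all add: diff_diff_eq diff_diff_eq2 diff_add_eq)
qed

lemma turns_cos2:
  assumes "t \<in> turns q" "t' \<in> turns r"
  shows "cos (t - t') = cos (q - r)"
proof -
  have "cos (t - t') = cos (t - r)" using assms by (intro turns_cos)
  also have "\<dots> = cos (r - t)" using cos_minus[of "r - t"] by simp
  also have "\<dots> = cos (r - q)" using assms by (intro turns_cos)
  also have "\<dots> = cos (q - r)" using cos_minus[of "r - q"] by simp
  finally show ?thesis .
qed

lemma turns_separated:
  assumes "cos (q - r) \<le> -1/2"
  shows "separated (turns q \<union> turns r)" "turns q \<inter> turns r = {}"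
proof -
  have fin: "finite (turns q \<union> turns r)" by (simp add: turns_def)
  have same: "2*pi/3 \<le> \<bar>t - t'\<bar>" if "t \<in> turns p" "t' \<in> turns p" "t \<noteq> t'" for t t' p
  proof -
    have "2*pi \<le> \<bar>t - t'\<bar>" using that by (auto simp: turns_def)
    then show ?thesis using pi_gt_zero by linarith
  qed
  have other: "2*pi/3 \<le> \<bar>t - t'\<bar>" if "t \<in> turns q" "t' \<in> turns r" for t t'
    using turns_cos2[OF that] assms by (intro cos_le_neg_half_imp) simp
  show "separated (turns q \<union> turns r)"
    unfolding separated_def
  proof (intro conjI ballI impI fin)
    fix t t' assume "t \<in> turns q \<union> turns r" "t' \<in> turns q \<union> turns r" "t \<noteq> t'"
    then show "2*pi/3 \<le> \<bar>t - t'\<bar>"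
      using same[of t q t'] same[of t r t'] other[of t t'] other[of t' t] abs_minus_commute[of t t'] by auto
  qed
  have "t \<noteq> t'" if "t \<in> turns q" "t' \<in> turns r" for t t'
    using other[OF that] pi_gt_zero by (intro notI) simp
  then show "turns q \<inter> turns r = {}" by blast
qed

text \<open>The bounds of \<open>edge_bound\<close> for the triangles of the fan telescope to the
  increase of the potential over a full turn. The two jumps contained in it turn
  \<open>n * exc\<close> into \<open>(n - 2) * exc\<close>.\<close>

theorem polygon_area_le:
  fixes V :: "(real^2) set" and q r :: "real^2"
  assumes V: "compact V" "convex V" "0 \<in> interior V" "V \<subseteq> cball 0 1"
    and fin: "finite {x. x extreme_point_of V}"
    and qr: "norm q = 1" "norm r = 1" "q \<bullet> r \<le> -1/2"
    and half: "\<And>x. x \<in> V \<Longrightarrow> x \<bullet> q \<le> 1/2" "\<And>x. x \<in> V \<Longrightarrow> x \<bullet> r \<le> 1/2"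
  shows "measure lborel V \<le> sqrt 3 / 2 + kap * (2 * pi / 3)
    + exc * (real (card {x. x extreme_point_of V}) - 2)"
proof -
  obtain n ph x R where "fan V n ph x R" and n: "n \<le> card {x. x extreme_point_of V}"
    using fan_exists[OF V(1-3) fin] .
  then interpret fan V n ph x R by simp
  obtain a where a: "ph 0 \<le> a" "a < ph 0 + 2*pi" "q = norm q *\<^sub>R pol a" by (rule polar_form[OF ph0])
  obtain b where b: "ph 0 \<le> b" "b < ph 0 + 2*pi" "r = norm r *\<^sub>R pol b" by (rule polar_form[OF ph0])
  have q: "q = pol a" and r: "r = pol b" using a b qr by auto
  have cab: "cos (a - b) \<le> -1/2" using qr by (simp add: q r inner_pol)
  define T where "T = turns a \<union> turns b"
  note T = turns_separated[OF cab, folded T_def]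
  have Rle: "R i \<le> 1" if "i \<le> n" for i
    using V(4) x_in[OF that] Rpos[OF that] by (auto simp: x)
  have Rcos: "R i * cos (ph i - t) \<le> 1/2" if "i \<le> n" "t \<in> T" for i t
  proof -
    have "R i * cos (ph i - a) \<le> 1/2" "R i * cos (ph i - b) \<le> 1/2"
      using half[OF x_in[OF that(1)]] by (simp_all add: x q r inner_pol)
    then show ?thesis using that(2) turns_cos unfolding T_def by auto
  qed
  have "measure lborel V \<le> (\<Sum>i<n. R i * R (Suc i) * sin (ph (Suc i) - ph i) / 2)"
    by (rule content_le[OF V(1)])
  also have "\<dots> \<le> (\<Sum>i<n. exc + (potential T (ph (Suc i)) - potential T (ph i)))"
  proof (rule sum_mono)
    fix i assume "i \<in> {..<n}"
    then have i: "i < n" by simp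
    show "R i * R (Suc i) * sin (ph (Suc i) - ph i) / 2 \<le> exc + (potential T (ph (Suc i)) - potential T (ph i))"
      using i mono[of i "Suc i"] gap[OF i] Rpos[of i] Rpos[of "Suc i"] Rle Rcos
      by (intro edge_bound T) auto
  qed
  also have "\<dots> = n * exc + (potential T (ph n) - potential T (ph 0))"
    using sum_lessThan_telescope[of "\<lambda>i. potential T (ph i)" n] by (simp add: sum.distrib)
  also have "potential T (ph n) - potential T (ph 0) = kap * (2*pi) + 2 * (sqrt 3 / 4 - 2 * kap * pi / 3 - exc)"
    unfolding ph_n potential_diff T_def
    using T(2) sum_sector_fun_turns[OF a(1,2)] sum_sector_fun_turns[OF b(1,2)]
    by (subst sum.union_disjoint) (auto simp: turns_def)
  also have "n * exc \<le> card {x. x extreme_point_of V} * exc"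
    using n exc_nonneg by (intro mult_right_mono) auto
  finally show ?thesis by (simp add: algebra_simps)
qed

section \<open>Voronoi cells and their vertices\<close>

lemma dist_le_iff_inner:
  fixes x :: "'a::real_inner"
  shows "dist x p \<le> dist x a \<longleftrightarrow> 2 * ((x - p) \<bullet> (a - p)) \<le> (a - p) \<bullet> (a - p)"
  by (simp add: dist_norm norm_le inner_diff inner_commute algebra_simps)

lemma dist_eq_iff_inner:
  fixes x :: "'a::real_inner"
  shows "dist x p = dist x a \<longleftrightarrow> 2 * ((x - p) \<bullet> (a - p)) = (a - p) \<bullet> (a - p)"
  by (simp add: dist_norm norm_eq inner_diff inner_commute algebra_simps)

definition rot :: "real^2 \<Rightarrow> real^2" where "rot w = vector [- w $ 2, w $ 1]"

lemma rot_nth [simp]: "rot w $ 1 = - w $ 2" "rot w $ 2 = w $ 1"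
  by (simp_all add: rot_def)

lemma rot_nonzero: "w \<noteq> 0 \<Longrightarrow> rot w \<noteq> 0"
  by (auto simp: vec2_eq_iff)

lemma rot_rot: "rot (rot w) = - w"
  by (simp add: vec2_eq_iff)

lemma inner_rot: "rot w \<bullet> w = 0"
  by (simp add: inner_2)

lemma orthogonal_rot:
  assumes "w \<noteq> 0" "x \<bullet> w = 0"
  obtains k where "x = k *\<^sub>R rot w"
proof -
  have "x $ 1 * w $ 1 + x $ 2 * w $ 2 = 0" using assms by (simp add: inner_2)
  moreover have "w $ 1 \<noteq> 0 \<or> w $ 2 \<noteq> 0" using assms by (simp add: vec2_eq_iff)
  ultimately have "x = (if w $ 1 \<noteq> 0 then x $ 2 / w $ 1 else - x $ 1 / w $ 2) *\<^sub>R rot w"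
    by (auto simp: vec2_eq_iff field_simps eq_neg_iff_add_eq_0)
  then show ?thesis by (rule that)
qed

text \<open>\<open>P\<close> is the set of centers. The direction \<open>w\<close> orders them from
  left to right without ties; heights are measured along \<open>rot w\<close>.\<close>

locale voronoi =
  fixes P :: "(real^2) set" and w :: "real^2"
  assumes locally_finite: "\<And>B. bounded B \<Longrightarrow> finite (P \<inter> B)"
    and covering: "\<And>x. \<exists>c\<in>P. dist x c \<le> 1"
    and generic: "w \<noteq> 0" "inj_on (\<lambda>x. x \<bullet> w) P"
begin

definition cell :: "real^2 \<Rightarrow> (real^2) set" where
  "cell p = {x. \<forall>a\<in>P. dist x p \<le> dist x a}"

definition near :: "real^2 \<Rightarrow> (real^2) set" where
  "near v = {a \<in> P. v \<in> cell a}"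

text \<open>A substitute for the extreme points of the cell that is suited to counting incidences;
  for a center \<open>p\<close> it contains all of them by \<open>extreme_card_near\<close>.\<close>

definition verts :: "real^2 \<Rightarrow> (real^2) set" where
  "verts p = {v. p \<in> near v \<and> 3 \<le> card (near v)}"

lemma cell_le_1: "x \<in> cell p \<Longrightarrow> dist x p \<le> 1"
  using covering[of x] by (force simp: cell_def)

lemma near_le_1: "a \<in> near v \<Longrightarrow> dist v a \<le> 1"
  using cell_le_1 by (auto simp: near_def)

lemma near_dist_eq: "a \<in> near v \<Longrightarrow> b \<in> near v \<Longrightarrow> dist v a = dist v b"
  by (force simp: near_def cell_def)

lemma finite_near [simp]: "finite (near v)"
proof (rule finite_subset)
  show "near v \<subseteq> P \<inter> cball v 1" using near_le_1 by (auto simp: near_def)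
qed (simp add: locally_finite)

lemma cell_cover: "\<exists>p\<in>P. x \<in> cell p"
proof -
  obtain c where c: "c \<in> P" "dist x c \<le> 1" using covering by blast
  let ?F = "P \<inter> cball x 1"
  have F: "finite ?F" "?F \<noteq> {}" using c by (auto intro: locally_finite)
  obtain p where p: "p \<in> ?F" "\<And>q. q \<in> ?F \<Longrightarrow> dist x p \<le> dist x q"
    using ex_is_arg_min_if_finite[OF F, of "dist x"] by (force simp: is_arg_min_linorder)
  have "dist x p \<le> dist x a" if "a \<in> P" for a
    using p that by (cases "dist x a \<le> 1") auto
  then show ?thesis using p by (auto simp: cell_def)
qed

lemma cell_halfspaces: "cell p = (\<Inter>a\<in>P. {x. (a - p) \<bullet> x \<le> ((a - p) \<bullet> (a - p)) / 2 + (a - p) \<bullet> p})"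
  by (auto simp: cell_def dist_le_iff_inner inner_diff_left inner_diff_right inner_commute field_simps)

lemma closed_cell: "closed (cell p)"
  unfolding cell_halfspaces by (intro closed_INT ballI closed_halfspace_le)

lemma convex_cell: "convex (cell p)"
  unfolding cell_halfspaces by (intro convex_INT ballI convex_halfspace_le)

lemma compact_cell: "compact (cell p)"
proof -
  have "cell p \<subseteq> cball p 1" using cell_le_1 by (auto simp: dist_commute)
  then have "bounded (cell p)" using bounded_cball bounded_subset by blast
  then show ?thesis using closed_cell compact_eq_bounded_closed by blast
qed

text \<open>By local finiteness only finitely many competitors lie within
  \<open>dist v p + 1\<close>, so the margin is a minimum over a finite set. The factor 2 allows
  \<open>v\<close> to be moved by \<open>e\<close>.\<close>

lemma gap_exists:
  assumes "p \<in> near v"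
  obtains e where "0 < e" "\<And>b. b \<in> P - near v \<Longrightarrow> dist v p + 2 * e \<le> dist v b"
proof -
  let ?F = "(P - near v) \<inter> cball v (dist v p + 1)"
  let ?D = "insert 1 ((\<lambda>b. dist v b - dist v p) ` ?F)"
  have fin: "finite ?D" using locally_finite[of "cball v (dist v p + 1)"]
    by (auto intro: finite_subset[rotated])
  have pos: "0 < dist v b - dist v p" if b: "b \<in> P - near v" for b
  proof -
    obtain a where "a \<in> P" "dist v a < dist v b" using b by (auto simp: near_def cell_def not_le)
    then show ?thesis using assms by (force simp: near_def cell_def)
  qed
  have M: "0 < Min ?D" using fin pos by (subst Min_gr_iff) auto
  show thesis
  proof (rule that[of "Min ?D / 2"])
    fix b assume b: "b \<in> P - near v"
    show "dist v p + 2 * (Min ?D / 2) \<le> dist v b"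
    proof (cases "dist v b \<le> dist v p + 1")
      case True
      then have "Min ?D \<le> dist v b - dist v p" using b fin by (intro Min_le) auto
      then show ?thesis by simp
    next
      case False
      moreover have "Min ?D \<le> 1" using fin by (intro Min_le) auto
      ultimately show ?thesis by simp
    qed
  qed (use M in simp)
qed

lemma interior_cell:
  assumes "p \<in> P"
  shows "p \<in> interior (cell p)"
proof -
  have np: "near p = {p}" using assms by (force simp: near_def cell_def)
  obtain e where e: "0 < e" "\<And>b. b \<in> P - {p} \<Longrightarrow> dist p p + 2 * e \<le> dist p b"
    using gap_exists[of p p] np by auto
  have "ball p e \<subseteq> cell p"
  proof
    fix x assume x: "x \<in> ball p e"
    have "dist x p \<le> dist x b" if "b \<in> P" for b
    proof (cases "b = p")
      case False
      then have "2 * e \<le> dist p b" using e that by auto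
      also have "\<dots> \<le> dist x p + dist x b" by (rule dist_triangle3)
      finally show ?thesis using x by (simp add: dist_commute)
    qed simp
    then show "x \<in> cell p" by (simp add: cell_def)
  qed
  then show ?thesis using e by (meson centre_in_ball interior_maximal open_ball subsetD)
qed

text \<open>With at most one further nearest center \<open>a\<close>, the point \<open>v\<close>
  could be moved both ways orthogonally to \<open>a - p\<close> within the cell, so it would be the
  midpoint of a segment.\<close>

lemma extreme_card_near:
  assumes p: "p \<in> P" and v: "v extreme_point_of cell p"
  shows "v \<in> verts p"
proof -
  have vc: "v \<in> cell p" using v by (simp add: extreme_point_of_def)
  then have pn: "p \<in> near v" using p by (simp add: near_def)
  have "3 \<le> card (near v)"
  proof (rule ccontr)
    assume "\<not> 3 \<le> card (near v)"
    then have "card (near v - {p}) \<le> 1" using pn by simp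
    then obtain a where a: "near v - {p} \<subseteq> {a}"
      by (metis One_nat_def card_le_Suc0_iff_eq finite_Diff finite_near insertI1 subsetI)
    obtain d :: "real^2" where d: "d \<noteq> 0" "d \<bullet> (a - p) = 0"
    proof (cases "a = p")
      case True
      then show ?thesis using that[of "pol 0"] by simp
    next
      case False
      then show ?thesis using that[of "rot (a - p)"] rot_nonzero[of "a - p"] inner_rot by simp
    qed
    obtain e where e: "0 < e" "\<And>b. b \<in> P - near v \<Longrightarrow> dist v p + 2 * e \<le> dist v b"
      using gap_exists[OF pn] by blast
    have mem: "v + g \<in> cell p" if g: "norm g = e" "g \<bullet> (a - p) = 0" for g
    proof -
      have "dist (v + g) p \<le> dist (v + g) b" if b: "b \<in> P" for b
      proof (cases "b \<in> near v")
        case True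
        then consider "b = p" | "b = a" using a by auto
        then show ?thesis
        proof cases
          case 2
          have "2 * ((v - p) \<bullet> (a - p)) = (a - p) \<bullet> (a - p)"
            using near_dist_eq[OF pn True] 2 by (simp add: dist_eq_iff_inner)
          then show ?thesis using g 2 by (simp add: dist_le_iff_inner inner_diff_left inner_add_left)
        qed simp
      next
        case False
        have "dist (v + g) p \<le> dist v p + e"
          using dist_triangle[of "v + g" p v] g by (simp add: dist_norm)
        moreover have "dist v b \<le> dist (v + g) b + e"
          using dist_triangle[of v b "v + g"] g by (simp add: dist_norm)
        ultimately show ?thesis using e(2)[of b] b False by auto
      qed
      then show ?thesis by (simp add: cell_def)
    qed
    define g where "g = (e / norm d) *\<^sub>R d"
    have g: "norm g = e" "g \<bullet> (a - p) = 0" using d e by (auto simp: g_def)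
    have "v + g \<in> cell p" "v - g \<in> cell p" using mem[of g] mem[of "- g"] g by auto
    moreover have "v \<in> open_segment (v + g) (v - g)"
    proof -
      have "g \<noteq> 0" using g e by auto
      moreover have "(v + g) - (v - g) = 2 *\<^sub>R g" by (simp add: scaleR_2)
      ultimately have "v + g \<noteq> v - g" by auto
      moreover have "v = (1 - 1/2) *\<^sub>R (v + g) + (1/2) *\<^sub>R (v - g)"
        by (simp add: vec2_eq_iff field_simps)
      ultimately show ?thesis unfolding in_segment
        by (intro conjI exI[of _ "1/2"]) auto
    qed
    ultimately show False using v unfolding extreme_point_of_def by blast
  qed
  then show ?thesis using pn by (simp add: verts_def)
qed

text \<open>For \<open>s = 1\<close> this says that \<open>v\<close> is the vertex of the cell of \<open>p\<close> that is extreme in the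
  direction orthogonal to \<open>w\<close>; for \<open>s = -1\<close>, in the opposite direction.\<close>

definition peak :: "real \<Rightarrow> real^2 \<Rightarrow> real^2 \<Rightarrow> bool" where
  "peak s p v \<longleftrightarrow> p \<in> near v \<and> (\<exists>a\<in>near v. \<exists>b\<in>near v. \<exists>\<alpha>>0. \<exists>\<beta>>0.
     a \<bullet> w < p \<bullet> w \<and> \<alpha> *\<^sub>R (a - p) + \<beta> *\<^sub>R (b - p) = s *\<^sub>R rot w)"

section \<open>Highest and lowest vertices of cells, and the number of vertices\<close>

lemma near_inner_le:
  assumes "p \<in> near v" "a \<in> near v" "p \<in> near v'"
  shows "(v' - v) \<bullet> (a - p) \<le> 0"
proof -
  have "dist v' p \<le> dist v' a" using assms by (auto simp: near_def cell_def)
  moreover have "dist v p = dist v a" using near_dist_eq assms by blast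
  ultimately show ?thesis by (simp add: dist_le_iff_inner dist_eq_iff_inner inner_diff_left)
qed

text \<open>\<open>a - p\<close> and \<open>b - p\<close> are outer normals of the cell at
  \<open>v\<close>, so \<open>v\<close> maximizes their positive combination
  \<open>s *\<^sub>R rot w\<close> on the cell. A tie must be a tie for each normal.\<close>

lemma peak_inner_le:
  assumes "peak s p v" "peak s' p v'"
  obtains a where "a \<bullet> w < p \<bullet> w" "s * ((v' - v) \<bullet> rot w) \<le> 0"
    "s * ((v' - v) \<bullet> rot w) = 0 \<longrightarrow> (v' - v) \<bullet> (a - p) = 0"
proof -
  obtain a b \<alpha> \<beta> where ab: "a \<in> near v" "b \<in> near v" "0 < \<alpha>" "0 < \<beta>" "a \<bullet> w < p \<bullet> w"
    and eq: "\<alpha> *\<^sub>R (a - p) + \<beta> *\<^sub>R (b - p) = s *\<^sub>R rot w"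
    using assms(1) unfolding peak_def by blast
  have pn: "p \<in> near v" "p \<in> near v'" using assms by (auto simp: peak_def)
  define A B where "A = (v' - v) \<bullet> (a - p)" and "B = (v' - v) \<bullet> (b - p)"
  have le: "A \<le> 0" "B \<le> 0" unfolding A_def B_def using near_inner_le pn ab by auto
  have "s * ((v' - v) \<bullet> rot w) = (v' - v) \<bullet> (s *\<^sub>R rot w)" by simp
  also have "\<dots> = \<alpha> * A + \<beta> * B"
    unfolding eq[symmetric] A_def B_def by (simp only: inner_add_right inner_scaleR_right)
  finally have "s * ((v' - v) \<bullet> rot w) = \<alpha> * A + \<beta> * B" .
  moreover have "\<alpha> * A \<le> 0" "\<beta> * B \<le> 0" using le ab by (auto simp: mult_le_0_iff)
  moreover have "A = 0" if "\<alpha> * A + \<beta> * B = 0"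
  proof -
    have "\<alpha> * A = 0" using that \<open>\<alpha> * A \<le> 0\<close> \<open>\<beta> * B \<le> 0\<close> by linarith
    then show ?thesis using ab by simp
  qed
  ultimately show thesis using that[of a] ab unfolding A_def by auto
qed

text \<open>Two maximizers differ by a multiple of \<open>w\<close> that is orthogonal to the normal
  \<open>a - p\<close>. Since \<open>a\<close> is to the left of \<open>p\<close>, this multiple is
  0.\<close>

lemma peak_unique:
  assumes pk: "peak s p v" "peak s p v'" and s: "s \<noteq> 0"
  shows "v = v'"
proof -
  obtain a where a: "a \<bullet> w < p \<bullet> w" "s * ((v' - v) \<bullet> rot w) \<le> 0"
    "s * ((v' - v) \<bullet> rot w) = 0 \<longrightarrow> (v' - v) \<bullet> (a - p) = 0"
    using peak_inner_le[OF pk] .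
  have a': "s * ((v - v') \<bullet> rot w) \<le> 0"
    using peak_inner_le[OF pk(2,1)] by blast
  have "s * ((v - v') \<bullet> rot w) = - (s * ((v' - v) \<bullet> rot w))"
    by (simp add: inner_diff_left algebra_simps)
  then have z: "s * ((v' - v) \<bullet> rot w) = 0" using a a' by linarith
  then have "(v' - v) \<bullet> rot w = 0" using s by simp
  then obtain k where "v' - v = k *\<^sub>R rot (rot w)"
    using orthogonal_rot[OF rot_nonzero[OF generic(1)]] by blast
  then have k: "v' - v = (- k) *\<^sub>R w" by (simp add: rot_rot)
  moreover have "(v' - v) \<bullet> (a - p) = 0" using a(3) z by blast
  ultimately have "- k * (w \<bullet> (a - p)) = 0" by simp
  moreover have "w \<bullet> (a - p) \<noteq> 0" using a(1) by (simp add: inner_diff_right inner_commute)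
  ultimately show ?thesis using k by simp
qed

text \<open>The segment from \<open>a\<close> to \<open>b\<close> crosses the line through
  \<open>p\<close> parallel to \<open>rot w\<close>, and the side of the crossing decides the sign.
  It misses \<open>p\<close> because the three centers lie on a circle around
  \<open>v\<close>.\<close>

lemma peak_exists:
  assumes n: "p \<in> near v" "a \<in> near v" "b \<in> near v" and ord: "a \<bullet> w < p \<bullet> w" "p \<bullet> w < b \<bullet> w"
  shows "peak 1 p v \<or> peak (-1) p v"
proof -
  define t where "t = (p \<bullet> w - a \<bullet> w) / (b \<bullet> w - a \<bullet> w)"
  have t: "0 < t" "t < 1" using ord by (auto simp: t_def field_simps)
  define z where "z = (1 - t) *\<^sub>R (a - p) + t *\<^sub>R (b - p)"
  have "z \<bullet> w = t * (b \<bullet> w - a \<bullet> w) - (p \<bullet> w - a \<bullet> w)"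
    by (simp add: z_def inner_add_left inner_diff_left algebra_simps)
  also have "\<dots> = 0" using ord by (simp add: t_def)
  finally obtain k where k: "z = k *\<^sub>R rot w" using orthogonal_rot[OF generic(1)] by blast
  have "z \<noteq> 0"
  proof
    assume "z = 0"
    then have "p = (1 - t) *\<^sub>R a + t *\<^sub>R b" by (simp add: z_def algebra_simps)
    then have "p \<in> open_segment a b" using t ord by (auto simp: in_segment)
    then have "dist v p < dist v a \<or> dist v p < dist v b" by (rule dist_decreases_open_segment)
    then show False using near_dist_eq[OF n(1,2)] near_dist_eq[OF n(1,3)] by auto
  qed
  then have k0: "k \<noteq> 0" using k by auto
  have "((1 - t) / \<bar>k\<bar>) *\<^sub>R (a - p) + (t / \<bar>k\<bar>) *\<^sub>R (b - p) = (1 / \<bar>k\<bar>) *\<^sub>R z"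
    by (simp add: z_def scaleR_add_right)
  also have "\<dots> = sgn k *\<^sub>R rot w" using k0 by (simp add: k sgn_real_def abs_if)
  finally have "peak (sgn k) p v"
    unfolding peak_def using n ord t k0
    by (intro conjI bexI[of _ a] bexI[of _ b] exI[of _ "(1 - t) / \<bar>k\<bar>"] exI[of _ "t / \<bar>k\<bar>"]) auto
  then show ?thesis using k0 by (auto simp: sgn_real_def split: if_splits)
qed

lemma card_near_le:
  assumes "3 \<le> card (near v)"
  shows "card (near v) \<le> 3 * (card {p \<in> near v. peak 1 p v} + card {p \<in> near v. peak (-1) p v})"
proof -
  have arith: "c \<le> 3 * m" if "c - 2 \<le> x" "x \<le> m" "3 \<le> c" for c x m :: nat using that by linarith
  let ?f = "\<lambda>x. x \<bullet> w"
  have ne: "near v \<noteq> {}" using assms by auto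
  obtain a where a: "a \<in> near v" "\<And>x. x \<in> near v \<Longrightarrow> ?f a \<le> ?f x"
    using ex_is_arg_min_if_finite[OF finite_near ne, of ?f] by (force simp: is_arg_min_linorder)
  obtain b where b: "b \<in> near v" "\<And>x. x \<in> near v \<Longrightarrow> ?f x \<le> ?f b"
    using ex_is_arg_min_if_finite[OF finite_near ne, of "\<lambda>x. - ?f x"] by (force simp: is_arg_min_linorder)
  have "near v - {a, b} \<subseteq> {p \<in> near v. peak 1 p v} \<union> {p \<in> near v. peak (-1) p v}"
  proof
    fix p assume p: "p \<in> near v - {a, b}"
    then have "?f a \<noteq> ?f p" "?f b \<noteq> ?f p"
      using generic(2) a b by (auto simp: inj_on_def near_def)
    then have "?f a < ?f p" "?f p < ?f b" using a(2)[of p] b(2)[of p] p by auto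
    then show "p \<in> {p \<in> near v. peak 1 p v} \<union> {p \<in> near v. peak (-1) p v}"
      using peak_exists[of p v a b] a b p by auto
  qed
  then have "card (near v - {a, b}) \<le> card ({p \<in> near v. peak 1 p v} \<union> {p \<in> near v. peak (-1) p v})"
    by (intro card_mono) auto
  also have "\<dots> \<le> card {p \<in> near v. peak 1 p v} + card {p \<in> near v. peak (-1) p v}"
    by (rule card_Un_le)
  finally have "card (near v - {a, b}) \<le> card {p \<in> near v. peak 1 p v} + card {p \<in> near v. peak (-1) p v}" .
  moreover have "card (near v) - 2 \<le> card (near v - {a, b})"
    using diff_card_le_card_Diff[of "{a, b}" "near v"] card_insert_le_m1[of 2 "{b}" a] by simp
  ultimately show ?thesis using arith[OF _ _ assms] by blast
qed

text \<open>Replaces the uniqueness of the circumcenter: being a peak at \<open>v\<close> depends on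
  \<open>v\<close> only through \<open>near v\<close>, and some center has a peak there.\<close>

lemma near_inj:
  assumes "near v = near v'" "3 \<le> card (near v)"
  shows "v = v'"
proof -
  have "card {p \<in> near v. peak 1 p v} + card {p \<in> near v. peak (-1) p v} \<noteq> 0"
    using card_near_le[OF assms(2)] assms(2) by (intro notI) simp
  then have "{p \<in> near v. peak 1 p v} \<noteq> {} \<or> {p \<in> near v. peak (-1) p v} \<noteq> {}"
    by (metis add_cancel_right_left card.empty)
  then obtain s p where sp: "s \<noteq> 0" "peak s p v"
  proof
    assume "{p \<in> near v. peak 1 p v} \<noteq> {}"
    then obtain p where "peak 1 p v" by blast
    then show ?thesis using that[of 1] by simp
  next
    assume "{p \<in> near v. peak (-1) p v} \<noteq> {}"
    then obtain p where "peak (-1) p v" by blast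
    then show ?thesis using that[of "-1"] by simp
  qed
  moreover have "peak s p v'" using sp assms(1) by (simp add: peak_def)
  ultimately show ?thesis using peak_unique by blast
qed

lemma near_verts_subset: "v \<in> verts p \<Longrightarrow> near v \<subseteq> P \<inter> cball p 2"
proof
  fix a assume "v \<in> verts p" "a \<in> near v"
  then have "dist v p \<le> 1" "dist v a \<le> 1" "a \<in> P" using near_le_1 by (auto simp: verts_def near_def)
  then show "a \<in> P \<inter> cball p 2" using dist_triangle3[of p a v] by auto
qed

lemma finite_verts: "finite (verts p)"
proof (rule inj_on_finite)
  show "inj_on near (verts p)" using near_inj by (auto simp: inj_on_def verts_def)
  show "near ` verts p \<subseteq> Pow (P \<inter> cball p 2)" using near_verts_subset by blast
  show "finite (Pow (P \<inter> cball p 2))" using locally_finite[OF bounded_cball] by (rule finite_Pow_iff[THEN iffD2])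
qed

lemma sum_card_peak_le:
  assumes "finite Q" "finite N" "s \<noteq> 0"
  shows "(\<Sum>v\<in>Q. card {p \<in> N. peak s p v}) \<le> card N"
proof -
  have "(\<Sum>v\<in>Q. card {p \<in> N. peak s p v}) = (\<Sum>p\<in>N. card {v \<in> Q. peak s p v})"
    using sum.swap_restrict[OF assms(1,2), of "\<lambda>_ _. 1::nat" "\<lambda>v p. peak s p v"] by simp
  also have "\<dots> \<le> (\<Sum>p\<in>N. 1)"
  proof (rule sum_mono)
    fix p assume "p \<in> N"
    have "card {v \<in> Q. peak s p v} \<le> Suc 0"
      using peak_unique[OF _ _ assms(3)] assms(1) by (subst card_le_Suc0_iff_eq) auto
    then show "card {v \<in> Q. peak s p v} \<le> 1" by simp
  qed
  finally show ?thesis by simp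
qed

text \<open>Double counting of incidences. The margin 2 around \<open>M\<close> ensures that all
  nearest centers of the vertices involved are in \<open>N\<close>, as \<open>card_near_le\<close>
  needs all of them.\<close>

lemma sum_card_verts_le:
  assumes M: "finite M" and N: "finite N" "\<And>p. p \<in> M \<Longrightarrow> P \<inter> cball p 2 \<subseteq> N"
  shows "(\<Sum>p\<in>M. card (verts p)) \<le> 6 * card N"
proof -
  define Q where "Q = (\<Union>p\<in>M. verts p)"
  have finQ: "finite Q" using M finite_verts by (auto simp: Q_def)
  have nN: "near v \<subseteq> N" if "v \<in> Q" for v using that N near_verts_subset unfolding Q_def by blast
  have "(\<Sum>p\<in>M. card (verts p)) = (\<Sum>p\<in>M. card {v \<in> Q. p \<in> near v})"
    by (intro sum.cong refl arg_cong[of _ _ card]) (auto simp: Q_def verts_def)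
  also have "\<dots> = (\<Sum>v\<in>Q. card {p \<in> M. p \<in> near v})"
    using sum.swap_restrict[OF finQ M, of "\<lambda>_ _. 1::nat" "\<lambda>v p. p \<in> near v"] by simp
  also have "\<dots> \<le> (\<Sum>v\<in>Q. 3 * (card {p \<in> N. peak 1 p v} + card {p \<in> N. peak (-1) p v}))"
  proof (rule sum_mono)
    fix v assume v: "v \<in> Q"
    have "card {p \<in> M. p \<in> near v} \<le> card (near v)" by (intro card_mono) auto
    also have "\<dots> \<le> 3 * (card {p \<in> near v. peak 1 p v} + card {p \<in> near v. peak (-1) p v})"
      using v by (intro card_near_le) (auto simp: Q_def verts_def)
    also have "\<dots> \<le> 3 * (card {p \<in> N. peak 1 p v} + card {p \<in> N. peak (-1) p v})"
      using nN[OF v] N by (intro mult_le_mono2 add_mono card_mono) auto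
    finally show "card {p \<in> M. p \<in> near v} \<le> 3 * (card {p \<in> N. peak 1 p v} + card {p \<in> N. peak (-1) p v})" .
  qed
  also have "\<dots> = 3 * ((\<Sum>v\<in>Q. card {p \<in> N. peak 1 p v}) + (\<Sum>v\<in>Q. card {p \<in> N. peak (-1) p v}))"
    by (simp add: sum.distrib flip: sum_distrib_left)
  also have "\<dots> \<le> 3 * (card N + card N)"
    by (intro mult_le_mono2 add_mono sum_card_peak_le finQ N) auto
  finally show ?thesis by simp
qed

text \<open>After moving \<open>p\<close> to 0, the bisectors towards \<open>q\<close> and
  \<open>r\<close> cut the cell off at distance at most \<open>1/2\<close>, so
  \<open>polygon_area_le\<close> applies with the unit vectors in these directions.\<close>

lemma measure_cell_le:
  assumes p: "p \<in> P" and q: "q \<in> P" "q \<noteq> p" "dist p q \<le> 1" and r: "r \<in> P" "r \<noteq> p" "dist p r \<le> 1"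
    and ang: "(q - p) \<bullet> (r - p) \<le> - (norm (q - p) * norm (r - p)) / 2"
  shows "measure lborel (cell p) \<le> (1 + sqrt 3 / 2) + exc * (real (card (verts p)) - 6)"
proof -
  define V where "V = (+) (- p) ` cell p"
  have ext: "{x. x extreme_point_of V} = (+) (- p) ` {x. x extreme_point_of cell p}"
    unfolding V_def by (rule extreme_points_of_translation)
  have sub: "{x. x extreme_point_of cell p} \<subseteq> verts p" using extreme_card_near[OF p] by auto
  have fin: "finite {x. x extreme_point_of V}"
    unfolding ext using finite_subset[OF sub finite_verts] by blast
  have card: "card {x. x extreme_point_of V} \<le> card (verts p)"
  proof -
    have "card {x. x extreme_point_of V} \<le> card {x. x extreme_point_of cell p}"
      unfolding ext using finite_subset[OF sub finite_verts] by (rule card_image_le)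
    also have "\<dots> \<le> card (verts p)" using sub finite_verts by (intro card_mono)
    finally show ?thesis .
  qed
  have half: "(x - p) \<bullet> ((c - p) /\<^sub>R norm (c - p)) \<le> 1/2"
    if c: "c \<in> P" "c \<noteq> p" "dist p c \<le> 1" and x: "x \<in> cell p" for c x
  proof -
    have n: "0 < norm (c - p)" using c by simp
    have "2 * ((x - p) \<bullet> (c - p)) \<le> (c - p) \<bullet> (c - p)"
      using x c(1) by (simp add: cell_def dist_le_iff_inner)
    then have "(x - p) \<bullet> (c - p) \<le> norm (c - p) * norm (c - p) / 2"
      by (simp add: dot_square_norm power2_eq_square)
    then have "(x - p) \<bullet> (c - p) / norm (c - p) \<le> norm (c - p) / 2"
      using n by (simp add: field_simps)
    also have "\<dots> \<le> 1/2" using c(3) by (simp add: dist_norm norm_minus_commute)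
    finally show ?thesis by (simp only: inner_scaleR_right divide_inverse_commute)
  qed
  have "measure lborel V \<le> sqrt 3 / 2 + kap * (2 * pi / 3) + exc * (real (card {x. x extreme_point_of V}) - 2)"
  proof (rule polygon_area_le)
    show "compact V" unfolding V_def by (rule compact_translation[OF compact_cell])
    show "convex V" unfolding V_def by (rule convex_translation[OF convex_cell])
    show "0 \<in> interior V" unfolding V_def interior_translation using interior_cell[OF p] by force
    show "V \<subseteq> cball 0 1" using cell_le_1 by (auto simp: V_def dist_norm norm_minus_commute)
    show "norm ((q - p) /\<^sub>R norm (q - p)) = 1" "norm ((r - p) /\<^sub>R norm (r - p)) = 1" using q r by auto
    show "((q - p) /\<^sub>R norm (q - p)) \<bullet> ((r - p) /\<^sub>R norm (r - p)) \<le> - 1 / 2"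
    proof -
      have "0 < norm (q - p)" "0 < norm (r - p)" using q r by auto
      then have "(q - p) \<bullet> (r - p) / (norm (q - p) * norm (r - p)) \<le> - 1 / 2"
        using ang by (subst pos_divide_le_eq) (auto simp: mult.commute)
      moreover have "inverse n * (inverse m * i) = i / (m * n)" for n m i :: real
        by (simp add: divide_inverse)
      ultimately show ?thesis by (simp only: inner_scaleR_left inner_scaleR_right)
    qed
    show "x \<bullet> ((q - p) /\<^sub>R norm (q - p)) \<le> 1/2" "x \<bullet> ((r - p) /\<^sub>R norm (r - p)) \<le> 1/2" if "x \<in> V" for x
      using half[OF q, of "p + x"] half[OF r, of "p + x"] that by (auto simp: V_def)
  qed (rule fin)
  also have "measure lborel V = measure lborel (cell p)"
  proof -
    have "measure lebesgue V = measure lebesgue (cell p)" unfolding V_def by (rule measure_translation)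
    moreover have "compact V" unfolding V_def by (rule compact_translation[OF compact_cell])
    then have "V \<in> sets lborel" "cell p \<in> sets lborel"
      using closed_cell by (auto intro: borel_compact)
    ultimately show ?thesis by (simp add: measure_completion)
  qed
  also have "exc * (real (card {x. x extreme_point_of V}) - 2) \<le> exc * (real (card (verts p)) - 2)"
    using card exc_nonneg by (intro mult_left_mono) auto
  \<comment> \<open>By definition \<open>4 * exc = 1 - kap * (2 * pi / 3)\<close>; this brings in
    the 6.\<close>
  also have "sqrt 3 / 2 + kap * (2 * pi / 3) + exc * (real (card (verts p)) - 2)
      = (1 + sqrt 3 / 2) + exc * (real (card (verts p)) - 6)"
    by (simp add: kap_def exc_def field_simps)
  finally show ?thesis by simp
qed

end

section \<open>The lower bound\<close>

lemma scaled_square: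
  assumes "0 < r"
  shows "(*\<^sub>R) r ` square = cbox (vector [-r, -r]) (vector [r, r])"
proof -
  have "(*\<^sub>R) r ` square = cbox (r *\<^sub>R vector [-1, -1]) (r *\<^sub>R vector [1, 1])"
  proof -
    have "(0 :: real^2) \<in> cbox (vector [-1, -1]) (vector [1, 1])" by (simp add: mem_box_cart forall_2)
    then have "cbox (vector [-1, -1]) (vector [1, 1]) \<noteq> ({} :: (real^2) set)" by blast
    then show ?thesis
      using assms image_smult_cbox[of r "vector [-1, -1] :: real^2" "vector [1, 1]"] by (simp add: square_def)
  qed
  moreover have "r *\<^sub>R vector [-1, -1] = (vector [-r, -r] :: real^2)" "r *\<^sub>R vector [1, 1] = (vector [r, r] :: real^2)"
    by (simp_all add: vec2_eq_iff)
  ultimately show ?thesis by simp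
qed

lemma mem_scaled_square:
  "0 < r \<Longrightarrow> x \<in> (*\<^sub>R) r ` square \<longleftrightarrow> \<bar>x $ 1\<bar> \<le> r \<and> \<bar>x $ 2\<bar> \<le> r"
  by (auto simp: scaled_square mem_box_cart forall_2 abs_le_iff)

lemma mem_interior_scaled_square:
  "0 < r \<Longrightarrow> x \<in> interior ((*\<^sub>R) r ` square) \<longleftrightarrow> \<bar>x $ 1\<bar> < r \<and> \<bar>x $ 2\<bar> < r"
  by (auto simp: scaled_square interior_cbox mem_box_cart forall_2 abs_less_iff)

lemma measure_scaled_square:
  assumes "0 < r"
  shows "measure lborel ((*\<^sub>R) r ` square) = 4 * r\<^sup>2"
proof -
  have "(vector [-r, -r] :: real^2) \<in> cbox (vector [-r, -r]) (vector [r, r])"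
    using assms by (simp add: mem_box_cart forall_2)
  then have "cbox (vector [-r, -r]) (vector [r, r]) \<noteq> ({} :: (real^2) set)" by blast
  then show ?thesis using assms
    by (simp add: scaled_square content_cbox_cart prod_2 power2_eq_square UNIV_2)
qed

lemma emeasure_scaled_square:
  assumes "0 < r"
  shows "emeasure lborel ((*\<^sub>R) r ` square) = ennreal (4 * r\<^sup>2)"
  unfolding measure_scaled_square[OF assms, symmetric] scaled_square[OF assms]
  by (rule emeasure_eq_ennreal_measure) (use emeasure_lborel_cbox_finite in \<open>simp add: less_top[symmetric]\<close>)

lemma emeasure_unit_disk: "emeasure lborel (unit_disk 0) = ennreal pi"
proof -
  have "measure lborel (cball (0::real^2) 1) = pi"
    using content_cball[of 1 "0::real^2"] by (simp add: unit_ball_vol_2)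
  then show ?thesis unfolding unit_disk_def
    using emeasure_eq_ennreal_measure[of lborel "cball (0::real^2) 1"] emeasure_lborel_cball_finite[of "0::real^2" 1]
    by auto
qed

lemma component_dist_le:
  fixes x y :: "real^2"
  shows "\<bar>x $ i\<bar> \<le> \<bar>y $ i\<bar> + dist x y"
  using component_le_norm_cart[of "x - y" i] by (simp add: dist_norm)

section \<open>Summing areas over the cells in a large square\<close>

context voronoi
begin

text \<open>The last inequality says that the angle at \<open>p\<close> is at least
  \<open>2 * pi / 3\<close>, whose cosine is \<open>-1/2\<close>.\<close>

definition good :: "real^2 \<Rightarrow> bool" where
  "good p \<longleftrightarrow> (\<exists>q\<in>P. \<exists>r\<in>P. q \<noteq> p \<and> dist p q \<le> 1 \<and> r \<noteq> p \<and> dist p r \<le> 1 \<and>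
     (q - p) \<bullet> (r - p) \<le> - (norm (q - p) * norm (r - p)) / 2)"

lemma measure_cell_le_4: "measure lborel (cell p) \<le> 4"
proof -
  let ?B = "cbox (vector [p $ 1 - 1, p $ 2 - 1]) (vector [p $ 1 + 1, p $ 2 + 1]) :: (real^2) set"
  have "p \<in> ?B" by (simp add: mem_box_cart forall_2)
  then have "?B \<noteq> {}" by blast
  have "cell p \<subseteq> ?B"
  proof
    fix x assume "x \<in> cell p"
    then have "dist x p \<le> 1" by (rule cell_le_1)
    then have "\<bar>(x - p) $ 1\<bar> \<le> 1" "\<bar>(x - p) $ 2\<bar> \<le> 1"
      using component_le_norm_cart[of "x - p" 1] component_le_norm_cart[of "x - p" 2]
      by (auto simp: dist_norm)
    then show "x \<in> ?B" by (auto simp: mem_box_cart forall_2)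
  qed
  then have "measure lborel (cell p) \<le> measure lborel ?B"
    using compact_cell by (intro measure_mono_fmeasurable) (auto intro: borel_compact fmeasurable_compact)
  also have "\<dots> = 4" using \<open>?B \<noteq> {}\<close> by (simp add: content_cbox_cart prod_2 UNIV_2)
  finally show ?thesis .
qed

text \<open>The cells of the centers in the square of half-side \<open>r\<close> cover the one of
  half-side \<open>r - 1\<close>; their vertices are counted against the centers up to
  \<open>r + 2\<close>. The summand 4 pays for the exceptional center.\<close>

lemma card_centers_ge:
  assumes E: "finite E" "card E \<le> 1" "\<And>p. p \<in> P - E \<Longrightarrow> good p" and r: "1 < r"
  shows "4 * (r - 1)\<^sup>2 \<le> (1 + sqrt 3 / 2) * real (card (P \<inter> (*\<^sub>R) (r + 2) ` square)) + 4"
proof -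
  define M where "M = P \<inter> (*\<^sub>R) r ` square"
  define N where "N = P \<inter> (*\<^sub>R) (r + 2) ` square"
  have "bounded ((*\<^sub>R) s ` square)" if "0 < s" for s using that by (simp add: scaled_square)
  then have fin: "finite M" "finite N" unfolding M_def N_def using r by (auto intro!: locally_finite)
  have MN: "M \<subseteq> N" using r by (intro subsetI) (simp add: M_def N_def mem_scaled_square)
  define A where "A = 1 + sqrt 3 / 2"
  \<comment> \<open>The sign allows replacing \<open>card M\<close> by the larger
    \<open>card N\<close> below.\<close>
  have A: "0 \<le> A - 6 * exc" using sqrt3_bounds exc_le by (simp add: A_def)
  have N2: "P \<inter> cball p 2 \<subseteq> N" if "p \<in> M" for p
  proof
    fix x assume x: "x \<in> P \<inter> cball p 2"
    have "\<bar>x $ 1\<bar> \<le> \<bar>p $ 1\<bar> + 2" "\<bar>x $ 2\<bar> \<le> \<bar>p $ 2\<bar> + 2"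
      using component_dist_le[of x 1 p] component_dist_le[of x 2 p] x by (auto simp: dist_commute)
    then show "x \<in> N" using x that r by (auto simp: M_def N_def mem_scaled_square)
  qed
  have "(*\<^sub>R) (r - 1) ` square \<subseteq> (\<Union>p\<in>M. cell p)"
  proof
    fix x assume x: "x \<in> (*\<^sub>R) (r - 1) ` square"
    obtain p where p: "p \<in> P" "x \<in> cell p" using cell_cover by blast
    then have "dist p x \<le> 1" using cell_le_1[of x p] by (simp add: dist_commute)
    then have "\<bar>p $ 1\<bar> \<le> \<bar>x $ 1\<bar> + 1" "\<bar>p $ 2\<bar> \<le> \<bar>x $ 2\<bar> + 1"
      using component_dist_le[of p 1 x] component_dist_le[of p 2 x] by auto
    then have "p \<in> M" using p x r by (auto simp: M_def mem_scaled_square)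
    then show "x \<in> (\<Union>p\<in>M. cell p)" using p by blast
  qed
  moreover have "compact (\<Union>p\<in>M. cell p)" using fin compact_cell by (intro compact_UN)
  moreover have "compact ((*\<^sub>R) (r - 1) ` square)" using r by (simp add: scaled_square)
  ultimately have "measure lborel ((*\<^sub>R) (r - 1) ` square) \<le> measure lborel (\<Union>p\<in>M. cell p)"
    by (intro measure_mono_fmeasurable fmeasurable_compact) (auto intro: borel_compact)
  also have "\<dots> \<le> (\<Sum>p\<in>M. measure lborel (cell p))"
    using fin compact_cell by (intro measure_UNION_le) (auto intro: borel_compact)
  also have "\<dots> \<le> (\<Sum>p\<in>M. (A - 6 * exc) + exc * real (card (verts p)) + (if p \<in> E then 4 else 0))"
  proof (rule sum_mono)
    fix p assume p: "p \<in> M"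
    show "measure lborel (cell p) \<le> (A - 6 * exc) + exc * real (card (verts p)) + (if p \<in> E then 4 else 0)"
    proof (cases "p \<in> E")
      case True
      then show ?thesis using measure_cell_le_4[of p] A exc_nonneg
        by (simp add: add_increasing)
    next
      case False
      then have "p \<in> P" "good p" using p E(3)[of p] by (auto simp: M_def)
      then obtain q r where "q \<in> P" "q \<noteq> p" "dist p q \<le> 1" "r \<in> P" "r \<noteq> p" "dist p r \<le> 1"
        "(q - p) \<bullet> (r - p) \<le> - (norm (q - p) * norm (r - p)) / 2" unfolding good_def by blast
      from measure_cell_le[OF \<open>p \<in> P\<close> this] show ?thesis
        using False by (simp add: A_def algebra_simps)
    qed
  qed
  also have "\<dots> = (A - 6 * exc) * card M + exc * real (\<Sum>p\<in>M. card (verts p)) + 4 * card (M \<inter> E)"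
    using fin by (simp add: sum.distrib sum.inter_restrict[symmetric] flip: sum_distrib_left)
  finally have "measure lborel ((*\<^sub>R) (r - 1) ` square)
      \<le> (A - 6 * exc) * card M + exc * real (\<Sum>p\<in>M. card (verts p)) + real (4 * card (M \<inter> E))" .
  moreover have "(A - 6 * exc) * card M \<le> (A - 6 * exc) * card N"
    using A card_mono[OF fin(2) MN] by (intro mult_left_mono) auto
  moreover have "exc * real (\<Sum>p\<in>M. card (verts p)) \<le> exc * real (6 * card N)"
    using sum_card_verts_le[OF fin N2] exc_nonneg by (intro mult_left_mono of_nat_mono) auto
  moreover have "card (M \<inter> E) \<le> card E" using E(1) by (intro card_mono) auto
  then have "real (4 * card (M \<inter> E)) \<le> 4" using E(2) by simp
  moreover have "(A - 6 * exc) * card N + exc * real (6 * card N) = A * card N"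
    by (simp add: algebra_simps)
  ultimately have "measure lborel ((*\<^sub>R) (r - 1) ` square) \<le> A * card N + 4" by linarith
  then show ?thesis using r by (simp add: measure_scaled_square A_def N_def)
qed

end

text \<open>Among the directions \<open>(1, t)\<close> each pair of distinct points excludes at most
  one \<open>t\<close>, and countably many values do not exhaust the reals.\<close>

lemma generic_direction:
  fixes P :: "(real^2) set"
  assumes "countable P"
  obtains w where "w \<noteq> 0" "inj_on (\<lambda>x. x \<bullet> w) P"
proof -
  define bad where "bad = (\<lambda>(x, y). - (x $ 1 - y $ 1) / (x $ 2 - y $ 2)) ` (P \<times> P)"
  have "countable bad" unfolding bad_def using assms by (intro countable_image countable_SIGMA)
  then have "bad \<noteq> UNIV" using uncountable_UNIV_real by metis
  then obtain t where t: "t \<notin> bad" by blast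
  show thesis
  proof (rule that[of "vector [1, t]"])
    show "vector [1, t] \<noteq> (0 :: real^2)" by (simp add: vec2_eq_iff)
    show "inj_on (\<lambda>x. x \<bullet> vector [1, t]) P"
    proof (rule inj_onI)
      fix x y assume xy: "x \<in> P" "y \<in> P" "x \<bullet> vector [1, t] = y \<bullet> vector [1, t]"
      then have eq: "x $ 1 - y $ 1 = - t * (x $ 2 - y $ 2)" by (simp add: inner_2 algebra_simps)
      have "x $ 2 = y $ 2"
      proof (rule ccontr)
        assume "x $ 2 \<noteq> y $ 2"
        then have "t = - (x $ 1 - y $ 1) / (x $ 2 - y $ 2)" using eq by simp
        then show False using t xy unfolding bad_def by (auto simp: image_iff)
      qed
      then show "x = y" using eq by (simp add: vec2_eq_iff)
    qed
  qed
qed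

section \<open>From centers to densities\<close>

definition hits :: "(nat \<Rightarrow> real^2) \<Rightarrow> real \<Rightarrow> (real^2) set set" where
  "hits C r = {S \<in> disk_family C. S \<inter> interior ((*\<^sub>R) r ` square) \<noteq> {}}"

lemma inj_unit_disk: "inj unit_disk"
  by (auto simp: inj_def unit_disk_def cball_eq_cball_iff)

lemma density_ratio_finite:
  assumes "0 < r" "finite (hits C r)"
  shows "density_ratio r (disk_family C) = ennreal (real (card (hits C r)) * pi / (4 * r\<^sup>2))"
proof -
  have "density_ratio r (disk_family C) = ennreal (real (card (hits C r))) * ennreal pi / ennreal (4 * r\<^sup>2)"
    unfolding density_ratio_def hits_def[symmetric] using assms
    by (simp add: emeasure_unit_disk emeasure_scaled_square ennreal_of_nat_eq_real_of_nat)
  also have "\<dots> = ennreal (real (card (hits C r)) * pi / (4 * r\<^sup>2))"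
    using assms by (simp add: divide_ennreal flip: ennreal_mult')
  finally show ?thesis .
qed

lemma density_ratio_infinite:
  assumes "0 < r" "infinite (hits C r)"
  shows "density_ratio r (disk_family C) = top"
  unfolding density_ratio_def hits_def[symmetric] using assms
  by (simp add: emeasure_unit_disk emeasure_scaled_square ennreal_top_mult ennreal_top_divide)

lemma hits_mono: "0 < r \<Longrightarrow> r \<le> s \<Longrightarrow> hits C r \<subseteq> hits C s"
  unfolding hits_def disjoint_iff by (auto simp: mem_interior_scaled_square)

lemma angle_inner_le:
  assumes "segment_angle A B C \<ge> 2 * pi / 3"
  shows "(A - B) \<bullet> (C - B) \<le> - (norm (A - B) * norm (C - B)) / 2"
proof (cases "norm (A - B) * norm (C - B) = 0")
  case True
  then show ?thesis by auto
next
  case False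
  define z where "z = ((A - B) \<bullet> (C - B)) / (norm (A - B) * norm (C - B))"
  have "\<bar>(A - B) \<bullet> (C - B)\<bar> \<le> norm (A - B) * norm (C - B)" by (rule Cauchy_Schwarz_ineq2)
  then have z: "-1 \<le> z" "z \<le> 1" using False unfolding z_def by (auto simp: field_simps abs_le_iff)
  have "cos (arccos z) \<le> cos (2 * pi / 3)"
    using assms z arccos_bounded[of z] unfolding segment_angle_def z_def[symmetric]
    by (intro cos_monotone_0_pi_le) auto
  then have "z \<le> -1/2" using z by (simp add: cos_120)
  moreover have "0 < norm (A - B) * norm (C - B)" using False by (simp add: less_le)
  ultimately show ?thesis unfolding z_def by (subst (asm) pos_divide_le_eq) auto
qed

text \<open>If some square is hit by infinitely many disks, the ratio is eventually infinite.
  Otherwise the centers are locally finite, and every center but \<open>C 1\<close> is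
  \<open>good\<close> thanks to its predecessor and its successor in the sequence.\<close>

theorem lower_density_ge:
  assumes C: "admissible_covering C"
  shows "ennreal (2 * pi / (2 + sqrt 3)) \<le> lower_density (disk_family C)"
proof -
  define g :: "real \<Rightarrow> real" where
    "g = (\<lambda>r. ((4 * (r - 4)\<^sup>2 - 4) / (1 + sqrt 3 / 2)) * pi / (4 * r\<^sup>2))"
  have "eventually (\<lambda>r. ennreal (g r) \<le> density_ratio r (disk_family C)) at_top"
  proof (cases "\<exists>r>0. infinite (hits C r)")
    case True
    then obtain r where r: "0 < r" "infinite (hits C r)" by blast
    have "density_ratio s (disk_family C) = top" if "r \<le> s" for s
      using r that hits_mono[of r s C] by (intro density_ratio_infinite) (auto dest: finite_subset)
    then have "ennreal (g s) \<le> density_ratio s (disk_family C)" if "r \<le> s" for s using that by simp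
    then show ?thesis using eventually_ge_at_top[of r] by (rule eventually_mono[rotated])
  next
    case False
    define P where "P = C ` {1..}"
    have fam: "disk_family C = unit_disk ` P" by (auto simp: disk_family_def P_def)
    obtain w where w: "w \<noteq> 0" "inj_on (\<lambda>x. x \<bullet> w) P"
      using generic_direction[of P] by (auto simp: P_def)
    have hit: "unit_disk p \<in> hits C r" if "p \<in> P" "0 < r" "\<bar>p $ 1\<bar> < r" "\<bar>p $ 2\<bar> < r" for p r
    proof -
      have "p \<in> unit_disk p \<inter> interior ((*\<^sub>R) r ` square)"
        using that by (auto simp: unit_disk_def mem_interior_scaled_square)
      then show ?thesis using that(1) unfolding hits_def fam by blast
    qed
    interpret voronoi P w
    proof
      fix B :: "(real^2) set" assume "bounded B"
      then obtain b where b: "\<And>x. x \<in> B \<Longrightarrow> norm x \<le> b" by (auto simp: bounded_iff)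
      define r where "r = \<bar>b\<bar> + 1"
      have "unit_disk ` (P \<inter> B) \<subseteq> hits C r"
      proof
        fix S assume "S \<in> unit_disk ` (P \<inter> B)"
        then obtain x where x: "x \<in> P" "x \<in> B" "S = unit_disk x" by blast
        then show "S \<in> hits C r"
          using hit[of x r] b[of x] component_le_norm_cart[of x 1] component_le_norm_cart[of x 2]
          by (auto simp: r_def)
      qed
      moreover have "finite (hits C r)" using False by (simp add: r_def)
      ultimately have "finite (unit_disk ` (P \<inter> B))" by (rule finite_subset)
      then show "finite (P \<inter> B)" by (rule finite_imageD) (use inj_unit_disk in \<open>auto simp: inj_on_def inj_def\<close>)
    next
      fix x :: "real^2"
      have "x \<in> \<Union> (unit_disk ` P)" using C by (simp add: admissible_covering_def fam)
      then show "\<exists>c\<in>P. dist x c \<le> 1" by (auto simp: unit_disk_def dist_commute)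
    qed (use w in auto)
    have good: "good p" if p: "p \<in> P - {C 1}" for p
    proof -
      obtain n where n: "1 \<le> n" "p = C n" using p by (auto simp: P_def)
      then have n2: "2 \<le> n" using p by (cases "n = 1") auto
      have a: "C n \<in> unit_disk (C (n - 1))" "C (n - 1) \<noteq> C n" "C (n + 1) \<noteq> C n"
        "segment_angle (C (n - 1)) (C n) (C (n + 1)) \<ge> 2 * pi / 3"
        using C n2 unfolding admissible_covering_def by auto
      have "C (n + 1) \<in> unit_disk (C n)"
        using C n2 unfolding admissible_covering_def by (auto dest: spec[of _ "n + 1"])
      then show ?thesis unfolding good_def using a angle_inner_le[OF a(4)] n n2
        by (intro bexI[of _ "C (n - 1)"] bexI[of _ "C (n + 1)"])
          (auto simp: P_def unit_disk_def dist_commute)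
    qed
    have "ennreal (g r) \<le> density_ratio r (disk_family C)" if r: "5 < r" for r
    proof -
      have A: "0 < 1 + sqrt 3 / 2" using sqrt3_bounds by linarith
      \<comment> \<open>With \<open>r - 3\<close> the centers counted have coordinates at most
        \<open>r - 1\<close>, so their disks hit the open square.\<close>
      have "4 * ((r - 3) - 1)\<^sup>2 \<le> (1 + sqrt 3 / 2) * real (card (P \<inter> (*\<^sub>R) ((r - 3) + 2) ` square)) + 4"
        using r good by (intro card_centers_ge[of "{C 1}"]) auto
      moreover have "card (P \<inter> (*\<^sub>R) ((r - 3) + 2) ` square) \<le> card (hits C r)"
      proof (rule card_inj_on_le)
        show "inj_on unit_disk (P \<inter> (*\<^sub>R) ((r - 3) + 2) ` square)"
          using inj_unit_disk by (auto simp: inj_on_def inj_def)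
        show "unit_disk ` (P \<inter> (*\<^sub>R) ((r - 3) + 2) ` square) \<subseteq> hits C r"
        proof
          fix S assume "S \<in> unit_disk ` (P \<inter> (*\<^sub>R) ((r - 3) + 2) ` square)"
          then obtain p where "p \<in> P" "p \<in> (*\<^sub>R) ((r - 3) + 2) ` square" "S = unit_disk p" by blast
          then show "S \<in> hits C r" using hit[of p r] r by (simp add: mem_scaled_square)
        qed
        show "finite (hits C r)" using False r by auto
      qed
      then have "(1 + sqrt 3 / 2) * real (card (P \<inter> (*\<^sub>R) ((r - 3) + 2) ` square))
          \<le> (1 + sqrt 3 / 2) * real (card (hits C r))"
        using A by (intro mult_left_mono) auto
      moreover have "(r - 3) - 1 = r - 4" by simp
      ultimately have "4 * (r - 4)\<^sup>2 - 4 \<le> (1 + sqrt 3 / 2) * real (card (hits C r))"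
        by simp
      with A have "(4 * (r - 4)\<^sup>2 - 4) / (1 + sqrt 3 / 2) \<le> real (card (hits C r))"
        by (simp add: pos_divide_le_eq mult.commute)
      then have "g r \<le> real (card (hits C r)) * pi / (4 * r\<^sup>2)"
        unfolding g_def by (intro divide_right_mono mult_right_mono) auto
      then show ?thesis using False r by (subst density_ratio_finite) (auto intro!: ennreal_leI)
    qed
    then show ?thesis using eventually_gt_at_top[of "5::real"] by (rule eventually_mono[rotated])
  qed
  then have "Liminf at_top (\<lambda>r. ennreal (g r)) \<le> lower_density (disk_family C)"
    unfolding lower_density_def by (rule Liminf_mono)
  moreover have "((\<lambda>r. ennreal (g r)) \<longlongrightarrow> ennreal (2 * pi / (2 + sqrt 3))) at_top"
  proof (rule tendsto_ennrealI)
    have "((\<lambda>r::real. (1 - 4 * inverse r)\<^sup>2 - (inverse r)\<^sup>2) \<longlongrightarrow> (1 - 4 * 0)\<^sup>2 - 0\<^sup>2) at_top"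
      by (intro tendsto_intros tendsto_inverse_0_at_top filterlim_ident)
    moreover have "\<forall>\<^sub>F r::real in at_top. (1 - 4 * inverse r)\<^sup>2 - (inverse r)\<^sup>2 = (4 * (r - 4)\<^sup>2 - 4) / (4 * r\<^sup>2)"
      using eventually_gt_at_top[of 0] by eventually_elim (simp add: field_simps power2_eq_square)
    ultimately have "((\<lambda>r::real. ((4 * (r - 4)\<^sup>2 - 4)) / (4 * r\<^sup>2)) \<longlongrightarrow> 1) at_top"
      by (simp add: tendsto_cong)
    then have "((\<lambda>r. (((4 * (r - 4)\<^sup>2 - 4)) / (4 * r\<^sup>2)) * (2 * pi / (2 + sqrt 3))) \<longlongrightarrow> 1 * (2 * pi / (2 + sqrt 3))) at_top"
      by (intro tendsto_mult tendsto_const)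
    moreover have "(((4 * (r - 4)\<^sup>2 - 4)) / (4 * r\<^sup>2)) * (2 * pi / (2 + sqrt 3)) = g r" for r
    proof -
      have eq: "1 + sqrt 3 / 2 = (2 + sqrt 3) / 2" by simp
      show ?thesis unfolding g_def eq by (simp add: mult_ac)
    qed
    ultimately show "(g \<longlongrightarrow> 2 * pi / (2 + sqrt 3)) at_top" by simp
  qed
  then have "Liminf at_top (\<lambda>r. ennreal (g r)) = ennreal (2 * pi / (2 + sqrt 3))"
    by (intro lim_imp_Liminf) auto
  ultimately show ?thesis by simp
qed

section \<open>A covering with optimal density\<close>

text \<open>Adjacent circles of a row meet at height \<open>sqrt 3 / 2\<close>, which is just where
  a disk of the next row, reaching down by 1, touches.\<close>

definition row_gap :: real where "row_gap = 1 + sqrt 3 / 2"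

definition lat :: "int \<Rightarrow> int \<Rightarrow> real^2" where
  "lat m n = vector [of_int m + of_int n / 2, of_int n * row_gap]"

text \<open>The \<open>t\<close>-th traversal runs along row number \<open>row t\<close>; the rows
  \<open>k, k - 1, ..., -k\<close>, up to the sign \<open>(-1) ^ k\<close>, are visited for
  \<open>t = k\<^sup>2, ..., k\<^sup>2 + 2 * k\<close>.\<close>

definition row :: "nat \<Rightarrow> int" where
  "row t = (let k = floor_sqrt t in (-1) ^ k * (int k + int k ^ 2 - int t))"

definition turn :: "nat \<Rightarrow> int" where "turn t = row (Suc t) - row t"

text \<open>The horizontal sense of the \<open>t\<close>-th traversal; consecutive ones run in
  opposite senses.\<close>

definition sg :: "nat \<Rightarrow> real" where "sg t = (-1) ^ t"

lemma row_gap_pos: "1 < row_gap" by (simp add: row_gap_def)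

lemma lat_nth [simp]: "lat m n $ 1 = of_int m + of_int n / 2" "lat m n $ 2 = of_int n * row_gap"
  by (simp_all add: lat_def)

lemma sg_cases: "sg t = 1 \<or> sg t = -1" by (cases "even t") (auto simp: sg_def)

lemma sg_Suc: "sg (Suc t) = - sg t" by (simp add: sg_def)

lemma row_eq:
  assumes "j \<le> 2 * k"
  shows "row (k\<^sup>2 + j) = (-1) ^ k * (int k - int j)"
proof -
  have "floor_sqrt (k\<^sup>2 + j) = k"
    using assms by (intro floor_sqrt_unique) (auto simp: power2_eq_square)
  then show ?thesis by (simp add: row_def Let_def)
qed

lemma nat_square_decomp:
  fixes t :: nat
  obtains k j where "t = k\<^sup>2 + j" "j \<le> 2 * k"
proof -
  define k where "k = floor_sqrt t"
  have "k\<^sup>2 \<le> t" "t < (Suc k)\<^sup>2" unfolding k_def by (simp, rule Suc_floor_sqrt_power2_gt)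
  then have "t = k\<^sup>2 + (t - k\<^sup>2)" "t - k\<^sup>2 \<le> 2 * k" by (auto simp: power2_eq_square)
  then show ?thesis by (rule that)
qed

text \<open>Within a sweep the rows follow one another. At its end the sign \<open>(-1) ^ k\<close>
  flips, so the next sweep starts one row further out on the same side.\<close>

lemma turn_cases: "turn t = 1 \<or> turn t = -1"
proof -
  obtain k j where kj: "t = k\<^sup>2 + j" "j \<le> 2 * k" by (rule nat_square_decomp)
  have "turn t = - ((-1) ^ k)"
  proof (cases "j = 2 * k")
    case True
    then have "Suc t = (Suc k)\<^sup>2 + 0" using kj by (simp add: power2_eq_square)
    then have "row (Suc t) = (-1) ^ Suc k * (int (Suc k) - int 0)" by (simp only: row_eq)
    moreover have "row t = (-1) ^ k * (int k - int j)" unfolding kj(1) by (rule row_eq[OF kj(2)])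
    ultimately show ?thesis using True by (simp add: turn_def algebra_simps)
  next
    case False
    then have "Suc t = k\<^sup>2 + Suc j" "Suc j \<le> 2 * k" using kj by auto
    then have "row (Suc t) = (-1) ^ k * (int k - int (Suc j))" by (simp only: row_eq)
    moreover have "row t = (-1) ^ k * (int k - int j)" unfolding kj(1) by (rule row_eq[OF kj(2)])
    ultimately show ?thesis by (simp add: turn_def algebra_simps)
  qed
  then show ?thesis by (cases "even k") auto
qed

text \<open>Traversal \<open>t\<close> has horizontal offset \<open>t / 2\<close>, row
  \<open>n\<close> has offset \<open>n / 2\<close>; equal parity makes them agree modulo 1.\<close>

lemma row_parity: "even (row t - int t)"
proof -
  obtain k j where kj: "t = k\<^sup>2 + j" "j \<le> 2 * k" by (rule nat_square_decomp)
  have "row t = (-1) ^ k * (int k - int j)" unfolding kj(1) by (rule row_eq[OF kj(2)])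
  then show ?thesis using kj(1) by (cases "even k") (auto simp: power2_eq_square)
qed

lemma row_visited:
  fixes n :: int and T :: nat
  obtains t where "T \<le> t" "row t = n"
proof -
  define k where "k = max T (nat \<bar>n\<bar>)"
  define j where "j = nat (int k - (-1) ^ k * n)"
  have n: "\<bar>n\<bar> \<le> int k" by (simp add: k_def)
  then have "\<bar>(-1) ^ k * n\<bar> \<le> int k" by (simp add: abs_mult)
  then have j: "int j = int k - (-1) ^ k * n" "j \<le> 2 * k" unfolding j_def by linarith+
  have "row (k\<^sup>2 + j) = (-1) ^ k * ((-1) ^ k * n)" using row_eq[OF j(2)] j(1) by simp
  also have "\<dots> = n" by (simp flip: mult.assoc power_mult_distrib)
  finally have "row (k\<^sup>2 + j) = n" .
  moreover have "T \<le> k" "k \<le> k\<^sup>2" by (simp add: k_def, cases k) (auto simp: power2_eq_square)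
  then have "T \<le> k\<^sup>2 + j" by linarith
  ultimately show ?thesis using that by blast
qed

text \<open>The lengths solve \<open>step1 - step2 / 2 = 1/2\<close> and
  \<open>(2 * step1 + step2) * sqrt 3 / 2 = row_gap\<close>: two steps of length
  \<open>step1\<close> and one of length \<open>step2\<close> lead from the end of a traversal to
  the start of the next.\<close>

definition step1 :: real where "step1 = 1/2 + sqrt 3 / 6"
definition step2 :: real where "step2 = sqrt 3 / 3"

text \<open>\<open>(t, i)\<close> is the \<open>i\<close>-th point of the \<open>t\<close>-th traversal. Its last two points leave the row
  in order to reach the next row with three turns by \<open>pi / 3\<close>.\<close>

definition pos :: "nat \<times> nat \<Rightarrow> real^2" where
  "pos = (\<lambda>(t, i).
     if i \<le> t then vector [sg t * (i - t / 2), row t * row_gap]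
     else if i = Suc t then vector [sg t * (t / 2 + step1 / 2), row t * row_gap + turn t * step1 * sqrt 3 / 2]
     else vector [sg t * (t / 2 + step1), row t * row_gap + turn t * step1 * sqrt 3])"

definition nxt :: "nat \<times> nat \<Rightarrow> nat \<times> nat" where
  "nxt = (\<lambda>(t, i). if i < Suc (Suc t) then (t, Suc i) else (Suc t, 0))"

definition dir :: "nat \<times> nat \<Rightarrow> real^2" where
  "dir = (\<lambda>(t, i). if i < t then vector [sg t, 0]
     else if i < Suc (Suc t) then vector [sg t / 2, turn t * sqrt 3 / 2]
     else vector [- sg t / 2, turn t * sqrt 3 / 2])"

definition len :: "nat \<times> nat \<Rightarrow> real" where
  "len = (\<lambda>(t, i). if i < t then 1 else if i < Suc (Suc t) then step1 else step2)"

definition valid :: "nat \<times> nat \<Rightarrow> bool" where "valid = (\<lambda>(t, i). i \<le> Suc (Suc t))"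

lemma valid_nxt: "valid s \<Longrightarrow> valid (nxt s)"
  by (auto simp: valid_def nxt_def split: prod.splits)

lemma len_bounds: "0 < len s" "len s \<le> 1"
  using sqrt3_bounds by (auto simp: len_def step1_def step2_def split: prod.splits)

lemma norm_dir: "norm (dir s) = 1"
proof -
  have "(dir s $ 1)\<^sup>2 + (dir s $ 2)\<^sup>2 = 1"
    using sg_cases[of "fst s"] turn_cases[of "fst s"]
    by (auto simp: dir_def power2_eq_square split: prod.splits)
  then show ?thesis by (simp add: norm_2)
qed

lemma pos_nxt:
  assumes "valid s"
  shows "pos (nxt s) - pos s = len s *\<^sub>R dir s"
proof -
  obtain t i where s: "s = (t, i)" by (cases s)
  consider "i < t" | "i = t" | "i = Suc t" | "i = Suc (Suc t)" using assms by (force simp: valid_def s le_Suc_eq order_le_less)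
  then show ?thesis
  proof cases
    case 4
    have "real_of_int (row (Suc t)) = row t + turn t" by (simp add: turn_def)
    then show ?thesis unfolding s 4 using turn_cases[of t]
      by (auto simp: pos_def nxt_def len_def dir_def vec2_eq_iff sg_Suc step1_def step2_def row_gap_def field_simps)
  qed (auto simp: s pos_def nxt_def len_def dir_def vec2_eq_iff algebra_simps)
qed

text \<open>Consecutive directions enclose the angle 0 or \<open>pi / 3\<close>.\<close>

lemma dir_inner:
  assumes "valid s"
  shows "1/2 \<le> dir s \<bullet> dir (nxt s)"
proof -
  obtain t i where s: "s = (t, i)" by (cases s)
  consider "i < t" "Suc i < t" | "i < t" "Suc i = t" | "i = t" | "i = Suc t" | "i = Suc (Suc t)"
    using assms by (force simp: valid_def s le_Suc_eq order_le_less)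
  then show ?thesis
    using sg_cases[of t] turn_cases[of t]
    by cases (auto simp: s nxt_def dir_def inner_2 sg_Suc)
qed

lemma segment_angle_pos:
  assumes "valid s"
  shows "2 * pi / 3 \<le> segment_angle (pos s) (pos (nxt s)) (pos (nxt (nxt s)))"
proof -
  have A: "pos s - pos (nxt s) = - (len s *\<^sub>R dir s)"
    using pos_nxt[OF assms] by (metis minus_diff_eq)
  have B: "pos (nxt (nxt s)) - pos (nxt s) = len (nxt s) *\<^sub>R dir (nxt s)"
    by (rule pos_nxt[OF valid_nxt[OF assms]])
  define z where "z = dir s \<bullet> dir (nxt s)"
  have "segment_angle (pos s) (pos (nxt s)) (pos (nxt (nxt s))) = arccos (- z)"
    unfolding segment_angle_def A B using len_bounds[of s] len_bounds[of "nxt s"]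
    by (simp add: norm_dir z_def)
  moreover have "z \<le> 1" using norm_cauchy_schwarz[of "dir s" "dir (nxt s)"] by (simp add: norm_dir z_def)
  moreover have "1/2 \<le> z" unfolding z_def by (rule dir_inner[OF assms])
  ultimately have "arccos (-1/2) \<le> segment_angle (pos s) (pos (nxt s)) (pos (nxt (nxt s)))"
    by (simp only:) (rule arccos_le_arccos, auto)
  moreover have "arccos (-1/2) = 2 * pi / 3" using arccos_cos[of "2 * pi / 3"] by (simp add: cos_120)
  ultimately show ?thesis by simp
qed

section \<open>The sequence of centers and the lattice points on it\<close>

definition snake :: "nat \<Rightarrow> real^2" where "snake n = pos ((nxt ^^ n) (0, 0))"

lemma valid_snake: "valid ((nxt ^^ n) (0, 0))"
  by (induction n) (auto intro: valid_nxt, simp add: valid_def)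

lemma snake_reaches: "i \<le> Suc (Suc t) \<Longrightarrow> \<exists>n. (nxt ^^ n) (0, 0) = (t, i)"
proof (induction t arbitrary: i)
  case 0
  then show ?case
  proof (induction i)
    case 0
    show ?case by (rule exI[of _ 0]) simp
  next
    case (Suc i)
    then obtain n where "(nxt ^^ n) (0, 0) = (0, i)" by auto
    then show ?case using Suc.prems by (intro exI[of _ "Suc n"]) (simp add: nxt_def)
  qed
next
  case (Suc t)
  show ?case using Suc.prems
  proof (induction i)
    case 0
    obtain n where "(nxt ^^ n) (0, 0) = (t, Suc (Suc t))" using Suc.IH[of "Suc (Suc t)"] by auto
    then show ?case by (intro exI[of _ "Suc n"]) (simp add: nxt_def)
  next
    case (Suc i)
    then obtain n where "(nxt ^^ n) (0, 0) = (Suc t, i)" by auto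
    then show ?case using Suc.prems by (intro exI[of _ "Suc n"]) (simp add: nxt_def)
  qed
qed

text \<open>Row \<open>k\<close> is traversed at arbitrarily late times \<open>t\<close>, each time
  over the interval \<open>[-t/2, t/2]\<close>. The summand 1 in \<open>T\<close> keeps
  \<open>n\<close> positive, as \<open>disk_family\<close> starts at index 1.\<close>

lemma lat_on_snake: "\<exists>n\<ge>1. snake n = lat m k"
proof -
  define T :: nat where "T = nat (\<bar>2 * m + k\<bar>) + 1"
  obtain t where t: "T \<le> t" "row t = k" by (rule row_visited)
  obtain j where j: "k - int t = 2 * j" using row_parity[of t] t(2) by (blast elim: evenE)
  \<comment> \<open>The solution of \<open>sg t * (i - t / 2) = m + k / 2\<close>, where
    \<open>k = t + 2 * j\<close>.\<close>
  define i where "i = (if sg t = 1 then m + k - j else - m - j)"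
  have bnd: "\<bar>2 * m + k\<bar> \<le> int t" using t(1) by (simp add: T_def)
  then have i: "0 \<le> i" "i \<le> int t" using j by (auto simp: i_def)
  have kj: "real_of_int k = real t + 2 * of_int j" using j by linarith
  have ri: "real (nat i) = real_of_int i" using i by simp
  have p: "pos (t, nat i) = lat m k"
  proof -
    have "sg t * (real_of_int i - t / 2) = of_int m + of_int k / 2"
      using sg_cases[of t] by (auto simp: i_def kj field_simps)
    then show ?thesis using i t(2) by (simp add: pos_def vec2_eq_iff ri)
  qed
  have "nat i \<le> Suc (Suc t)" using i by linarith
  then obtain n where n: "(nxt ^^ n) (0, 0) = (t, nat i)" using snake_reaches by blast
  have "n \<noteq> 0" using n t(1) by (intro notI) (simp add: T_def)
  then show ?thesis using n p by (intro exI[of _ n]) (simp add: snake_def)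
qed

lemma row_pos_lattice:
  assumes "i \<le> t"
  obtains m where "pos (t, i) = lat m (row t)"
proof -
  obtain j where j: "row t - int t = 2 * j" using row_parity[of t] by (blast elim: evenE)
  then have kj: "real_of_int (row t) = real t + 2 * of_int j" by linarith
  define m where "m = (if sg t = 1 then int i - int t - j else - int i - j)"
  have "sg t * (real i - t / 2) = of_int m + of_int (row t) / 2"
    using sg_cases[of t] by (auto simp: m_def kj field_simps)
  then have "pos (t, i) = lat m (row t)" using assms by (simp add: pos_def vec2_eq_iff)
  then show ?thesis by (rule that)
qed

section \<open>The lattice disks cover the plane\<close>

lemma dist_le_1_iff: "dist (x::real^2) y \<le> 1 \<longleftrightarrow> (x $ 1 - y $ 1)\<^sup>2 + (x $ 2 - y $ 2)\<^sup>2 \<le> 1"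
  by (simp add: dist_norm norm_2)

text \<open>The line \<open>e = 1 - d * (2 - sqrt 3)\<close> passes through the two intersection points of the unit
  circles around two nearby lattice points in consecutive rows.\<close>

lemma sum_squares_le_1_below_chord:
  fixes d e :: real
  assumes "0 \<le> d" "d \<le> 1/2" "0 \<le> e" "e \<le> 1 - d * (2 - sqrt 3)"
  shows "d\<^sup>2 + e\<^sup>2 \<le> 1"
proof -
  define c where "c = 2 - sqrt 3"
  have c: "0 < c" "c * c = 4 * c - 1" using sqrt3_bounds by (auto simp: c_def algebra_simps)
  have "e\<^sup>2 \<le> (1 - d * c)\<^sup>2" using assms by (intro power_mono) (auto simp: c_def)
  also have "(1 - d * c)\<^sup>2 = 1 - 2 * d * c + d * d * (c * c)" by (simp add: power2_eq_square algebra_simps)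
  also have "\<dots> = 1 - d\<^sup>2 - 2 * d * c * (1 - 2 * d)" unfolding c(2) by (simp add: power2_eq_square algebra_simps)
  finally have "d\<^sup>2 + e\<^sup>2 \<le> 1 - 2 * d * c * (1 - 2 * d)" by simp
  moreover have "0 \<le> 2 * d * c * (1 - 2 * d)" using assms c by (intro mult_nonneg_nonneg) auto
  ultimately show ?thesis by linarith
qed

text \<open>Below the chord line the nearest lattice point of the row under \<open>x\<close> serves.
  Replacing \<open>\<bar>f\<bar>\<close> by \<open>1/2 - \<bar>f\<bar>\<close> and \<open>e\<close>
  by \<open>row_gap - e\<close> exchanges the two sides of the line, so otherwise a point of the
  next row serves.\<close>

lemma lattice_covers: "\<exists>m n. dist (lat m n) x \<le> 1"
proof -
  define n where "n = \<lfloor>x $ 2 / row_gap\<rfloor>"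
  define e where "e = x $ 2 - of_int n * row_gap"
  define m where "m = \<lfloor>x $ 1 - of_int n / 2 + 1/2\<rfloor>"
  define f where "f = x $ 1 - (of_int m + of_int n / 2)"
  have gp: "0 < row_gap" using row_gap_pos by simp
  have "of_int n \<le> x $ 2 / row_gap" "x $ 2 / row_gap < of_int n + 1" unfolding n_def by linarith+
  then have e: "0 \<le> e" "e \<le> row_gap" using gp by (auto simp: e_def field_simps)
  have f: "\<bar>f\<bar> \<le> 1/2" unfolding f_def m_def by linarith
  have x: "x $ 1 = of_int m + of_int n / 2 + f" "x $ 2 = of_int n * row_gap + e" by (auto simp: f_def e_def)
  show ?thesis
  proof (cases "e \<le> 1 - \<bar>f\<bar> * (2 - sqrt 3)")
    case True
    then have "\<bar>f\<bar>\<^sup>2 + e\<^sup>2 \<le> 1" using f e by (intro sum_squares_le_1_below_chord) auto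
    then have "dist (lat m n) x \<le> 1" unfolding dist_le_1_iff x by simp
    then show ?thesis by blast
  next
    case False
    have "row_gap - e \<le> 1 - (1/2 - \<bar>f\<bar>) * (2 - sqrt 3)" using False by (simp add: row_gap_def algebra_simps)
    then have main: "(1/2 - \<bar>f\<bar>)\<^sup>2 + (row_gap - e)\<^sup>2 \<le> 1" using f e by (intro sum_squares_le_1_below_chord) auto
    show ?thesis
    proof (cases "0 \<le> f")
      case True
      have "lat m (n + 1) $ 1 - x $ 1 = 1/2 - f" "lat m (n + 1) $ 2 - x $ 2 = row_gap - e"
        by (simp_all add: x algebra_simps add_divide_distrib)
      then have "dist (lat m (n + 1)) x \<le> 1" unfolding dist_le_1_iff using main True by simp
      then show ?thesis by blast
    next
      case False
      have "lat (m - 1) (n + 1) $ 1 - x $ 1 = - (1/2 + f)" "lat (m - 1) (n + 1) $ 2 - x $ 2 = row_gap - e"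
        by (simp_all add: x algebra_simps add_divide_distrib)
      then have "dist (lat (m - 1) (n + 1)) x \<le> 1" unfolding dist_le_1_iff using main False
        by (simp only: power2_minus) simp
      then show ?thesis by blast
    qed
  qed
qed

lemma snake_admissible: "admissible_covering snake"
  unfolding admissible_covering_def
proof (intro conjI allI impI)
  show "\<Union> (disk_family snake) = UNIV"
  proof (intro equalityI subsetI UNIV_I)
    fix x :: "real^2"
    obtain m k where mk: "dist (lat m k) x \<le> 1" using lattice_covers by blast
    obtain n where n: "n \<ge> 1" "snake n = lat m k" using lat_on_snake by blast
    have "x \<in> unit_disk (snake n)" using mk by (simp add: n(2) unit_disk_def)
    moreover have "unit_disk (snake n) \<in> disk_family snake" using n(1) by (auto simp: disk_family_def)
    ultimately show "x \<in> \<Union> (disk_family snake)" by blast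
  qed
next
  fix n :: nat assume "2 \<le> n"
  then obtain k where n: "n = Suc k" by (cases n) auto
  define s where "s = (nxt ^^ k) (0, 0)"
  have v: "valid s" unfolding s_def by (rule valid_snake)
  have sn: "snake (n - 1) = pos s" "snake n = pos (nxt s)" "snake (n + 1) = pos (nxt (nxt s))"
    by (simp_all add: n snake_def s_def)
  have d: "dist (pos s) (pos (nxt s)) = len s" if "valid s" for s
    using len_bounds[of s] by (subst dist_commute) (simp add: dist_norm pos_nxt[OF that] norm_dir)
  show "snake n \<in> unit_disk (snake (n - 1))"
    using d[OF v] len_bounds[of s] unfolding sn by (simp add: unit_disk_def)
  show "snake (n - 1) \<noteq> snake n" using d[OF v] len_bounds[of s] unfolding sn by auto
  show "snake (n + 1) \<noteq> snake n" using d[OF valid_nxt[OF v]] len_bounds[of "nxt s"] unfolding sn by auto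
  show "2 * pi / 3 \<le> segment_angle (snake (n - 1)) (snake n) (snake (n + 1))"
    unfolding sn by (rule segment_angle_pos[OF v])
qed

section \<open>The density of the constructed covering\<close>

lemma card_int_interval:
  fixes a b :: real
  assumes "a \<le> b"
  shows "finite {m::int. a < of_int m \<and> of_int m < b}" "real (card {m::int. a < of_int m \<and> of_int m < b}) \<le> b - a + 1"
proof -
  have sub: "{m::int. a < of_int m \<and> of_int m < b} \<subseteq> {\<lceil>a\<rceil>..\<lfloor>b\<rfloor>}" by (auto simp: ceiling_le_iff le_floor_iff)
  then show "finite {m::int. a < of_int m \<and> of_int m < b}" by (rule finite_subset) simp
  have "card {m::int. a < of_int m \<and> of_int m < b} \<le> card {\<lceil>a\<rceil>..\<lfloor>b\<rfloor>}" using sub by (intro card_mono) auto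
  also have "\<dots> = nat (\<lfloor>b\<rfloor> + 1 - \<lceil>a\<rceil>)" by simp
  finally have "real (card {m::int. a < of_int m \<and> of_int m < b}) \<le> real (nat (\<lfloor>b\<rfloor> + 1 - \<lceil>a\<rceil>))" by simp
  also have "\<dots> \<le> b - a + 1"
  proof (cases "0 \<le> \<lfloor>b\<rfloor> + 1 - \<lceil>a\<rceil>")
    case True
    then have "real (nat (\<lfloor>b\<rfloor> + 1 - \<lceil>a\<rceil>)) = of_int (\<lfloor>b\<rfloor> + 1 - \<lceil>a\<rceil>)" by simp
    also have "\<dots> \<le> b - a + 1" by linarith
    finally show ?thesis .
  qed (use assms in simp)
  finally show "real (card {m::int. a < of_int m \<and> of_int m < b}) \<le> b - a + 1" .
qed

lemma card_lattice_le:
  assumes "0 < r"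
  defines "L \<equiv> {lat m n | m n. \<bar>lat m n $ 1\<bar> < r \<and> \<bar>lat m n $ 2\<bar> < r}"
  shows "finite L" "real (card L) \<le> (2 * r / row_gap + 1) * (2 * r + 1)"
proof -
  define N where "N = {n::int. - (r / row_gap) < of_int n \<and> of_int n < r / row_gap}"
  define M where "M n = {m::int. - r - of_int n / 2 < of_int m \<and> of_int m < r - of_int n / 2}" for n :: int
  have gp: "0 < row_gap" using row_gap_pos by simp
  have N: "finite N" "real (card N) \<le> 2 * r / row_gap + 1"
    using card_int_interval[of "- (r / row_gap)" "r / row_gap"] assms gp unfolding N_def by auto
  have M: "finite (M n)" "real (card (M n)) \<le> 2 * r + 1" for n
    using card_int_interval[of "- r - of_int n / 2" "r - of_int n / 2"] assms unfolding M_def by auto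
  have sub: "L \<subseteq> (\<lambda>(n, m). lat m n) ` (SIGMA n:N. M n)"
  proof
    fix x assume "x \<in> L"
    then obtain m n where mn: "x = lat m n" "\<bar>lat m n $ 1\<bar> < r" "\<bar>lat m n $ 2\<bar> < r" by (auto simp: L_def)
    then have "n \<in> N" "m \<in> M n" using gp by (auto simp: N_def M_def abs_less_iff field_simps)
    then show "x \<in> (\<lambda>(n, m). lat m n) ` (SIGMA n:N. M n)" using mn by force
  qed
  have finS: "finite (SIGMA n:N. M n)" using N M by auto
  then show "finite L" using finite_subset[OF sub] by blast
  have "card L \<le> card (SIGMA n:N. M n)" using surj_card_le[OF finS sub] .
  also have "\<dots> = (\<Sum>n\<in>N. card (M n))" using N M by simp
  finally have "real (card L) \<le> (\<Sum>n\<in>N. real (card (M n)))" by (simp flip: of_nat_sum)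
  also have "\<dots> \<le> (\<Sum>n\<in>N. 2 * r + 1)" using M by (intro sum_mono) auto
  also have "\<dots> = real (card N) * (2 * r + 1)" by simp
  also have "\<dots> \<le> (2 * r / row_gap + 1) * (2 * r + 1)" using N assms by (intro mult_right_mono) auto
  finally show "real (card L) \<le> (2 * r / row_gap + 1) * (2 * r + 1)" .
qed

text \<open>A center in the square of half-side \<open>r + 1\<close> is a lattice point, counted
  once however often it is visited, or one of the two connecting points of a traversal
  \<open>t\<close>. The latter are at least \<open>t / 2\<close> away from the vertical axis, so
  only linearly many occur.\<close>

lemma hits_snake:
  assumes "0 < r"
  shows "finite (hits snake r)"
    "real (card (hits snake r)) \<le> (2 * (r + 1) / row_gap + 3) * (2 * (r + 1) + 1)"
proof -
  define L where "L = {lat m n | m n. \<bar>lat m n $ 1\<bar> < r + 1 \<and> \<bar>lat m n $ 2\<bar> < r + 1}"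
  define T where "T = nat \<lceil>2 * (r + 1)\<rceil>"
  define E where "E = (\<lambda>(t, j). pos (t, Suc t + j)) ` ({..<T} \<times> {0, 1::nat})"
  have L: "finite L" "real (card L) \<le> (2 * (r + 1) / row_gap + 1) * (2 * (r + 1) + 1)"
    using card_lattice_le[of "r + 1"] assms unfolding L_def by auto
  have finE: "finite E" by (simp add: E_def)
  have "card E \<le> T * 2"
    unfolding E_def using card_image_le[of "{..<T} \<times> {0, 1::nat}" "\<lambda>(t, j). pos (t, Suc t + j)"]
    by (simp add: card_cartesian_product)
  then have "real (card E) \<le> real T * 2" by (metis of_nat_le_iff of_nat_mult of_nat_numeral)
  moreover have "real T \<le> 2 * (r + 1) + 1"
  proof -
    have "real T = of_int \<lceil>2 * (r + 1)\<rceil>" unfolding T_def using assms by (intro of_nat_nat) simp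
    then show ?thesis by linarith
  qed
  ultimately have E: "real (card E) \<le> 2 * (2 * (r + 1) + 1)" by simp
  have sub: "hits snake r \<subseteq> unit_disk ` (L \<union> E)"
  proof
    fix S assume "S \<in> hits snake r"
    then have S: "S \<in> disk_family snake" "S \<inter> interior ((*\<^sub>R) r ` square) \<noteq> {}"
      by (simp_all add: hits_def)
    obtain y where "y \<in> S" "y \<in> interior ((*\<^sub>R) r ` square)" using S(2) by blast
    moreover obtain n where "S = unit_disk (snake n)" using S(1) unfolding disk_family_def by blast
    ultimately have n: "S = unit_disk (snake n)" "y \<in> S" "\<bar>y $ 1\<bar> < r" "\<bar>y $ 2\<bar> < r"
      using assms by (simp_all add: mem_interior_scaled_square)
    then have "dist (snake n) y \<le> 1" by (simp add: unit_disk_def)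
    then have b: "\<bar>snake n $ 1\<bar> < r + 1" "\<bar>snake n $ 2\<bar> < r + 1"
      using component_dist_le[of "snake n" 1 y] component_dist_le[of "snake n" 2 y] n by auto
    obtain t i where ti: "(nxt ^^ n) (0, 0) = (t, i)" by force
    then have i: "i \<le> Suc (Suc t)" using valid_snake[of n] by (simp add: valid_def)
    have s: "snake n = pos (t, i)" by (simp add: snake_def ti)
    have "snake n \<in> L \<union> E"
    proof (cases "i \<le> t")
      case True
      then obtain m where "pos (t, i) = lat m (row t)" by (rule row_pos_lattice)
      then have "snake n \<in> L" using b s unfolding L_def by auto
      then show ?thesis by simp
    next
      case False
      have "real t / 2 \<le> \<bar>snake n $ 1\<bar>"
        using False sg_cases[of t] sqrt3_bounds by (auto simp: s pos_def step1_def abs_mult)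
      then have "real t < 2 * (r + 1)" using b by simp
      then have "t < T" unfolding T_def by linarith
      moreover have "i = Suc t + (i - Suc t)" "i - Suc t \<in> {0, 1}" using False i by auto
      ultimately have "snake n \<in> E" unfolding E_def s by (auto intro!: image_eqI[of _ _ "(t, i - Suc t)"])
      then show ?thesis by simp
    qed
    then show "S \<in> unit_disk ` (L \<union> E)" using n by simp
  qed
  have fin: "finite (L \<union> E)" using L finE by simp
  show "finite (hits snake r)" using finite_subset[OF sub] fin by simp
  have "card (hits snake r) \<le> card (L \<union> E)" by (rule surj_card_le[OF fin sub])
  also have "\<dots> \<le> card L + card E" by (rule card_Un_le)
  finally have "real (card (hits snake r)) \<le> real (card L) + real (card E)" by linarith
  then show "real (card (hits snake r)) \<le> (2 * (r + 1) / row_gap + 3) * (2 * (r + 1) + 1)"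
    using L E by (simp add: algebra_simps)
qed

lemma snake_density_le: "lower_density (disk_family snake) \<le> ennreal (2 * pi / (2 + sqrt 3))"
proof -
  define g :: "real \<Rightarrow> real" where
    "g = (\<lambda>r. ((2 * (r + 1) / row_gap + 3) * (2 * (r + 1) + 1)) * pi / (4 * r\<^sup>2))"
  have "eventually (\<lambda>r. density_ratio r (disk_family snake) \<le> ennreal (g r)) at_top"
    using eventually_gt_at_top[of "0::real"]
  proof eventually_elim
    case (elim r)
    then show ?case unfolding g_def using hits_snake[OF elim]
      by (subst density_ratio_finite) (auto intro!: ennreal_leI divide_right_mono mult_right_mono)
  qed
  then have "lower_density (disk_family snake) \<le> Liminf at_top (\<lambda>r. ennreal (g r))"
    unfolding lower_density_def by (rule Liminf_mono)
  moreover have "((\<lambda>r. ennreal (g r)) \<longlongrightarrow> ennreal (2 * pi / (2 + sqrt 3))) at_top"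
  proof (rule tendsto_ennrealI)
    have "((\<lambda>r::real. ((1 + inverse r) / row_gap + 3/2 * inverse r) * (1 + 3/2 * inverse r) * pi)
        \<longlongrightarrow> ((1 + 0) / row_gap + 3/2 * 0) * (1 + 3/2 * 0) * pi) at_top"
      using row_gap_pos by (intro tendsto_intros tendsto_inverse_0_at_top filterlim_ident) auto
    moreover have "\<forall>\<^sub>F r::real in at_top.
        ((1 + inverse r) / row_gap + 3/2 * inverse r) * (1 + 3/2 * inverse r) * pi = g r"
      using eventually_gt_at_top[of 0]
    proof eventually_elim
      case (elim r)
      have a: "(1 + inverse r) / row_gap + 3/2 * inverse r = (2 * (r + 1) / row_gap + 3) / (2 * r)"
        "1 + 3/2 * inverse r = (2 * (r + 1) + 1) / (2 * r)"
        using elim row_gap_pos by (auto simp: field_simps)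
      show ?case unfolding a g_def by (simp add: power2_eq_square)
    qed
    moreover have "((1 + 0) / row_gap + 3/2 * 0) * (1 + 3/2 * 0) * pi = 2 * pi / (2 + sqrt 3)"
    proof -
      have eq: "row_gap = (2 + sqrt 3) / 2" by (simp add: row_gap_def)
      show ?thesis unfolding eq by simp
    qed
    ultimately show "(g \<longlongrightarrow> 2 * pi / (2 + sqrt 3)) at_top" by (simp only: tendsto_cong)
  qed
  then have "Liminf at_top (\<lambda>r. ennreal (g r)) = ennreal (2 * pi / (2 + sqrt 3))"
    by (intro lim_imp_Liminf) auto
  ultimately show ?thesis by simp
qed

theorem theorem1p4:
  shows "optimal_lower_density \<ge> ennreal (2 * pi / (2 + sqrt 3)) \<and>
         (\<exists>C. admissible_covering C \<and>
              lower_density (disk_family C) = ennreal (2 * pi / (2 + sqrt 3)))"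
proof
  show "ennreal (2 * pi / (2 + sqrt 3)) \<le> optimal_lower_density"
    unfolding optimal_lower_density_def by (intro INF_greatest lower_density_ge) simp
  show "\<exists>C. admissible_covering C \<and> lower_density (disk_family C) = ennreal (2 * pi / (2 + sqrt 3))"
    using snake_admissible snake_density_le lower_density_ge[OF snake_admissible]
    by (intro exI[of _ snake]) (auto intro: antisym)
qed

end
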